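(* Let $\Omega \subset \mathbb{R}^N$ be a bounded domain satisfying the uniform exterior sphere condition, and let $u_0 \in C_0(\bar\Omega)$ with $u_0 \ge 0$ and $u_0 \not\equiv 0$. Let $u$ be the (unique nonnegative) viscosity solution to $$\partial_t u = \Delta_\infty u \ \text{ in } (0,\infty)\times\Omega, \qquad u = 0 \ \text{ on } (0,\infty)\times\partial\Omega, \qquad u(0,x)=u_0(x) \ \text{ for } x\in\bar\Omega ,$$ and let $f_\infty\in C_0(\bar\Omega)$ be the unique positive viscosity solution to $$-\Delta_\infty f_\infty - \frac{f_\infty}{2} = 0 \ \text{ in } \Omega, \qquad f_\infty > 0 \ \text{ in } \Omega, \qquad f_\infty = 0 \ \text{ on } \partial\Omega .$$ Then $$u(t,x)\le t^{-1/2} f_\infty(x) \qquad\text{for all } (t,x)\in(0,\infty)\times\bar\Omega .$$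
   Context: Notation. $B(x,r)=\{y\in\mathbb{R}^N : |y-x|<r\}$; $C_0(\bar\Omega)=\{f\in C(\bar\Omega): f=0 \text{ on }\partial\Omega\}$; $\mathcal{S}(N)$ is the set of symmetric real $N\times N$ matrices; $USC$ and $LSC$ denote upper and lower semicontinuous real-valued functions. The infinity-Laplacian is $\Delta_\infty u = \langle D^2u\,\nabla u,\nabla u\rangle = \sum_{i,j} \frac{\partial^2 u}{\partial x_i\partial x_j}\frac{\partial u}{\partial x_i}\frac{\partial u}{\partial x_j}$. Uniform exterior sphere condition: there is $R>0$ such that for every $x_0\in\partial\Omega$ there is $y_0\in\mathbb{R}^N$ with $|x_0-y_0|=R$ and $B(y_0,R)\cap\Omega=\emptyset$. Parabolic viscosity solutions. Let $Q=(0,\infty)\times\Omega$. For $(t_0,x_0)\in Q$, $\mathcal{P}^{2,+}u(t_0,x_0)$ is the set of $(s,p,X)\in\mathbb{R}\times\mathbb{R}^N\times\mathcal{S}(N)$ such that $u(t,x)\le u(t_0,x_0)+s(t-t_0)+\langle p,x-x_0\rangle+\frac12\langle X(x-x_0),x-x_0\rangle+o(|t-t_0|+|x-x_0|^2)$ as $(t,x)\to(t_0,x_0)$, and $\mathcal{P}^{2,-}u(t_0,x_0)=-\mathcal{P}^{2,+}(-u)(t_0,x_0)$. A function $u\in USC(\bar Q)$ is a viscosity subsolution of the initial-boundary value problem if $s-\langle Xp,p\rangle\le 0$ for all $(s,p,X)\in\mathcal{P}^{2,+}u(t_0,x_0)$ and all $(t_0,x_0)\in Q$, $u\le 0$ on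 $(0,\infty)\times\partial\Omega$, and $u(0,x)\le u_0(x)$ for $x\in\bar\Omega$. A function $u\in LSC(\bar Q)$ is a viscosity supersolution if $s-\langle Xp,p\rangle\ge 0$ for all $(s,p,X)\in\mathcal{P}^{2,-}u(t_0,x_0)$ and all $(t_0,x_0)\in Q$, $u\ge 0$ on $(0,\infty)\times\partial\Omega$, and $u(0,x)\ge u_0(x)$ for $x\in\bar\Omega$. A viscosity solution is a function $u\in C(\bar Q)$ that is both. It is known that, under the stated assumptions on $\Omega$ and $u_0$, there is a unique nonnegative viscosity solution. Elliptic viscosity solutions. For $x_0\in\Omega$, $\mathcal{J}^{2,+}w(x_0)$ is the set of $(p,X)\in\mathbb{R}^N\times\mathcal{S}(N)$ with $w(x)\le w(x_0)+\langle p,x-x_0\rangle+\frac12\langle X(x-x_0),x-x_0\rangle+o(|x-x_0|^2)$ as $x\to x_0$, and $\mathcal{J}^{2,-}w(x_0)=-\mathcal{J}^{2,+}(-w)(x_0)$. A function $w$ is a viscosity subsolution (resp. supersolution) of $-\Delta_\infty\zeta-\zeta/2=0$ in $\Omega$ if it is usc (resp. lsc) and $-\langle Xp,p\rangle-\frac{w(x_0)}{2}\le 0$ for all $(p,X)\in\mathcal{J}^{2,+}w(x_0)$ (resp. $\ge 0$ for all $(p,X)\in\mathcal{J}^{2,-}w(x_0)$), for all $x_0\in\Omega$; a viscosity solution is a continuous function that is both. The existence and uniqueness of $f_\infty$ is part of the paper's main theorem, under the stated assumption on $\Omega$. *)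

theory Defs
  imports "HOL-Analysis.Analysis" "HOL-Library.Landau_Symbols"
begin

definition uniform_exterior_sphere :: "(real^'n) set \<Rightarrow> bool" where
  "uniform_exterior_sphere \<Omega> \<longleftrightarrow>
     (\<exists>R>0. \<forall>x0\<in>frontier \<Omega>. \<exists>y0. dist x0 y0 = R \<and> ball y0 R \<inter> \<Omega> = {})"

definition C0_closure :: "(real^'n) set \<Rightarrow> (real^'n \<Rightarrow> real) set" where
  "C0_closure \<Omega> = {f. continuous_on (closure \<Omega>) f \<and> (\<forall>x\<in>frontier \<Omega>. f x = 0)}"

definition usc_on :: "'a::topological_space set \<Rightarrow> ('a \<Rightarrow> real) \<Rightarrow> bool" where
  "usc_on S f \<longleftrightarrow> (\<forall>x\<in>S. \<forall>a>f x. \<forall>\<^sub>F y in at x within S. f y < a)"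

definition lsc_on :: "'a::topological_space set \<Rightarrow> ('a \<Rightarrow> real) \<Rightarrow> bool" where
  "lsc_on S f \<longleftrightarrow> (\<forall>x\<in>S. \<forall>a<f x. \<forall>\<^sub>F y in at x within S. a < f y)"


text \<open>
  Functions are total in HOL, but the semijets below are only used at points of the open sets
  \<open>{0<..} \<times> \<Omega>\<close> and \<open>\<Omega>\<close>, where the filter \<open>at\<close> sees no values from outside these sets.
  In the viscosity inequalities, \<open>(X *v p) \<bullet> p\<close> stands for
  \<open>\<Delta>\<^sub>\<infinity> u = (D\<^sup>2u *v \<nabla>u) \<bullet> \<nabla>u\<close>: the equations are \<open>\<partial>\<^sub>t u - \<Delta>\<^sub>\<infinity> u = 0\<close> in
  \<open>{0<..} \<times> \<Omega>\<close> and \<open>- \<Delta>\<^sub>\<infinity> w - w / 2 = 0\<close> in \<open>\<Omega>\<close>.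
\<close>

definition par_superjet ::
  "(real \<times> (real^'n) \<Rightarrow> real) \<Rightarrow> real \<times> (real^'n) \<Rightarrow> (real \<times> (real^'n) \<times> (real^'n^'n)) set" where
  "par_superjet u = (\<lambda>(t0, x0). {(s, p, X). transpose X = X \<and>
     (\<exists>r \<in> o[at (t0, x0)](\<lambda>(t, x). \<bar>t - t0\<bar> + (norm (x - x0))\<^sup>2).
        \<forall>\<^sub>F (t, x) in at (t0, x0).
          u (t, x) \<le> u (t0, x0) + s * (t - t0) + p \<bullet> (x - x0)
                      + (1/2) * ((X *v (x - x0)) \<bullet> (x - x0)) + r (t, x))})"

definition par_subjet ::
  "(real \<times> (real^'n) \<Rightarrow> real) \<Rightarrow> real \<times> (real^'n) \<Rightarrow> (real \<times> (real^'n) \<times> (real^'n^'n)) set" where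
  "par_subjet u z0 = uminus ` par_superjet (\<lambda>z. - u z) z0"

definition par_viscosity_subsolution ::
  "(real^'n) set \<Rightarrow> (real^'n \<Rightarrow> real) \<Rightarrow> (real \<times> (real^'n) \<Rightarrow> real) \<Rightarrow> bool" where
  "par_viscosity_subsolution \<Omega> u0 u \<longleftrightarrow>
     usc_on (closure ({0<..} \<times> \<Omega>)) u \<and>
     (\<forall>z0 \<in> {0<..} \<times> \<Omega>. \<forall>(s, p, X) \<in> par_superjet u z0. s - (X *v p) \<bullet> p \<le> 0) \<and>
     (\<forall>t>0. \<forall>x\<in>frontier \<Omega>. u (t, x) \<le> 0) \<and>
     (\<forall>x\<in>closure \<Omega>. u (0, x) \<le> u0 x)"

definition par_viscosity_supersolution ::
  "(real^'n) set \<Rightarrow> (real^'n \<Rightarrow> real) \<Rightarrow> (real \<times> (real^'n) \<Rightarrow> real) \<Rightarrow> bool" where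
  "par_viscosity_supersolution \<Omega> u0 u \<longleftrightarrow>
     lsc_on (closure ({0<..} \<times> \<Omega>)) u \<and>
     (\<forall>z0 \<in> {0<..} \<times> \<Omega>. \<forall>(s, p, X) \<in> par_subjet u z0. s - (X *v p) \<bullet> p \<ge> 0) \<and>
     (\<forall>t>0. \<forall>x\<in>frontier \<Omega>. u (t, x) \<ge> 0) \<and>
     (\<forall>x\<in>closure \<Omega>. u (0, x) \<ge> u0 x)"

definition par_viscosity_solution ::
  "(real^'n) set \<Rightarrow> (real^'n \<Rightarrow> real) \<Rightarrow> (real \<times> (real^'n) \<Rightarrow> real) \<Rightarrow> bool" where
  "par_viscosity_solution \<Omega> u0 u \<longleftrightarrow>
     continuous_on (closure ({0<..} \<times> \<Omega>)) u \<and>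
     par_viscosity_subsolution \<Omega> u0 u \<and> par_viscosity_supersolution \<Omega> u0 u"


definition ell_superjet ::
  "(real^'n \<Rightarrow> real) \<Rightarrow> real^'n \<Rightarrow> ((real^'n) \<times> (real^'n^'n)) set" where
  "ell_superjet w x0 = {(p, X). transpose X = X \<and>
     (\<exists>r \<in> o[at x0](\<lambda>x. (norm (x - x0))\<^sup>2).
        \<forall>\<^sub>F x in at x0.
          w x \<le> w x0 + p \<bullet> (x - x0) + (1/2) * ((X *v (x - x0)) \<bullet> (x - x0)) + r x)}"

definition ell_subjet ::
  "(real^'n \<Rightarrow> real) \<Rightarrow> real^'n \<Rightarrow> ((real^'n) \<times> (real^'n^'n)) set" where
  "ell_subjet w x0 = uminus ` ell_superjet (\<lambda>x. - w x) x0"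

definition ell_viscosity_subsolution :: "(real^'n) set \<Rightarrow> (real^'n \<Rightarrow> real) \<Rightarrow> bool" where
  "ell_viscosity_subsolution \<Omega> w \<longleftrightarrow>
     usc_on \<Omega> w \<and>
     (\<forall>x0\<in>\<Omega>. \<forall>(p, X) \<in> ell_superjet w x0. - ((X *v p) \<bullet> p) - w x0 / 2 \<le> 0)"

definition ell_viscosity_supersolution :: "(real^'n) set \<Rightarrow> (real^'n \<Rightarrow> real) \<Rightarrow> bool" where
  "ell_viscosity_supersolution \<Omega> w \<longleftrightarrow>
     lsc_on \<Omega> w \<and>
     (\<forall>x0\<in>\<Omega>. \<forall>(p, X) \<in> ell_subjet w x0. - ((X *v p) \<bullet> p) - w x0 / 2 \<ge> 0)"

definition ell_viscosity_solution :: "(real^'n) set \<Rightarrow> (real^'n \<Rightarrow> real) \<Rightarrow> bool" where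
  "ell_viscosity_solution \<Omega> w \<longleftrightarrow>
     continuous_on \<Omega> w \<and> ell_viscosity_subsolution \<Omega> w \<and> ell_viscosity_supersolution \<Omega> w"

end

theory Submission
  imports Defs
begin

text \<open>
  Separation of variables reduces the parabolic comparison to an elliptic one: if
  \<open>h = t - t\<^sup>2/T\<close> then \<open>w x = max\<^sub>t \<surd>(h t) * (u (t, x) - \<epsilon>)\<close> satisfies
  \<open>- \<Delta>\<^sub>\<infinity> w \<le> h' w / 2 \<le> w / 2\<close> wherever \<open>w > 0\<close>, and \<open>w > 0\<close> only on a compact subset of \<open>\<Omega>\<close>.
  If \<open>w \<le> f\<close> failed, then \<open>V = \<theta> f\<close> with \<open>\<theta> = max (w / f) > 1\<close> would touch \<open>w\<close> from above, while
  \<open>- \<Delta>\<^sub>\<infinity> V \<ge> \<theta>\<^sup>2 V / 2\<close> is strictly larger than \<open>w / 2\<close> there. This is refuted without the theorem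
  on sums, by an argument in the style of Armstrong and Smart: one looks at the maximum of
  \<open>max w - min V\<close> over small balls and compares \<open>w\<close> and \<open>V\<close> with radial functions
  \<open>\<alpha> + \<beta> \<rho> - k \<rho>\<^sup>2/2\<close> on the balls of twice the radius. Passing from \<open>w x\<close> and \<open>V x\<close> to \<open>w x + z\<close> and
  \<open>V x + z\<close> with one more variable \<open>z\<close> does not change \<open>\<Delta>\<^sub>\<infinity>\<close> but makes all slopes at least 1, which
  keeps the degenerate equation away from vanishing gradients. Letting \<open>T \<rightarrow> \<infinity>\<close> and \<open>\<epsilon> \<rightarrow> 0\<close> gives
  \<open>\<surd>t * u (t, x) \<le> f x\<close>.
\<close>

section \<open>Viscosity inequalities tested by quadratic polynomials\<close>

text \<open>This is the viscosity form of \<Delta>_\<infinity> W \<ge> B at \<open>y\<close>, with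
  quadratic polynomials that dominate \<open>W\<close> without remainder as test functions. A
  supersolution \<open>f\<close> is treated through \<open>- f\<close>; as the operator is odd, one
  notion serves both sides.\<close>

definition touch_bound :: "(real^'n \<Rightarrow> real) \<Rightarrow> real^'n \<Rightarrow> real \<Rightarrow> bool" where
  "touch_bound W y B \<longleftrightarrow> (\<forall>p X. transpose X = X \<longrightarrow>
     (\<forall>\<^sub>F x in at y. W x \<le> W y + p \<bullet> (x - y) + (1/2) * ((X *v (x - y)) \<bullet> (x - y))) \<longrightarrow>
     B \<le> (X *v p) \<bullet> p)"

lemma touch_bound_mono: "touch_bound W y B \<Longrightarrow> B' \<le> B \<Longrightarrow> touch_bound W y B'"
  unfolding touch_bound_def by (meson order_trans)

text \<open>The infinity-Laplacian is homogeneous of degree 3: dividing a test polynomial for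
  \<open>c * W\<close> by \<open>c\<close> divides \<open>(X *v p) \<bullet> p\<close> by
  \<open>c ^ 3\<close>.\<close>

lemma touch_bound_scale:
  fixes W :: "real^'n \<Rightarrow> real"
  assumes "touch_bound W y B" "c > 0"
  shows "touch_bound (\<lambda>x. c * W x) y (c ^ 3 * B)"
  unfolding touch_bound_def
proof (intro allI impI)
  fix p :: "real^'n" and X :: "real^'n^'n"
  assume X: "transpose X = X"
    and ev: "\<forall>\<^sub>F x in at y. c * W x \<le> c * W y + p \<bullet> (x - y) + (1/2) * ((X *v (x - y)) \<bullet> (x - y))"
  let ?X = "(1/c) *\<^sub>R X" and ?p = "(1/c) *\<^sub>R p"
  have "transpose ?X = ?X"
    using X by (simp add: transpose_def vec_eq_iff)
  moreover have "\<forall>\<^sub>F x in at y. W x \<le> W y + ?p \<bullet> (x - y) + (1/2) * ((?X *v (x - y)) \<bullet> (x - y))"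
    using ev
  proof eventually_elim
    case (elim x)
    then have "c * W x / c \<le> (c * W y + p \<bullet> (x - y) + (1/2) * ((X *v (x - y)) \<bullet> (x - y))) / c"
      using \<open>c > 0\<close> by (intro divide_right_mono) auto
    then show ?case
      using \<open>c > 0\<close> by (simp add: scaleR_matrix_vector_assoc[symmetric] add_divide_distrib)
  qed
  ultimately have "B \<le> (?X *v ?p) \<bullet> ?p"
    using assms(1) unfolding touch_bound_def by blast
  also have "\<dots> = (X *v p) \<bullet> p / c ^ 3"
    by (simp add: scaleR_matrix_vector_assoc[symmetric] matrix_vector_mult_scaleR power3_eq_cube)
  finally show "c ^ 3 * B \<le> (X *v p) \<bullet> p"
    using \<open>c > 0\<close> by (simp add: field_simps)
qed

text \<open>The polynomial has gradient \<open>\<kappa> *\<^sub>R v\<close> and Hessian 2 L I + 2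
  \<mu> v v^T at \<open>y\<close>; the conclusion evaluates this form on the gradient. The tests
  built from radial functions below are all of this type.\<close>

lemma touch_boundD_rank_one:
  fixes v :: "real^'n"
  assumes "touch_bound W y B"
    and ev: "\<forall>\<^sub>F x in at y. W x \<le> W y + \<kappa> * (v \<bullet> (x - y)) + L * (norm (x - y))\<^sup>2
                                + \<mu> * (v \<bullet> (x - y))\<^sup>2"
  shows "B \<le> 2 * \<kappa>\<^sup>2 * (L * (norm v)\<^sup>2 + \<mu> * (norm v) ^ 4)"
proof -
  define X :: "real^'n^'n" where "X = mat (2 * L) + (\<chi> i j. 2 * \<mu> * (v $ i * v $ j))"
  have Xmul: "X *v h = (2 * L) *\<^sub>R h + (2 * \<mu> * (v \<bullet> h)) *\<^sub>R v" for h
  proof -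
    have "(\<chi> i j. 2 * \<mu> * (v $ i * v $ j)) *v h = (2 * \<mu> * (v \<bullet> h)) *\<^sub>R v"
      by (simp add: vec_eq_iff matrix_vector_mult_def inner_vec_def sum_distrib_left sum_distrib_right mult_ac)
    moreover have "(mat (2 * L) :: real^'n^'n) *v h = (2 * L) *\<^sub>R h"
      by (simp add: vec_eq_iff matrix_vector_mult_def mat_def if_distrib[where f="\<lambda>a. a * _"] cong: if_cong)
    ultimately show ?thesis by (simp add: X_def matrix_vector_mult_add_rdistrib)
  qed
  have "transpose X = X"
    by (simp add: X_def transpose_def vec_eq_iff mat_def mult.commute)
  moreover have "\<forall>\<^sub>F x in at y. W x \<le> W y + (\<kappa> *\<^sub>R v) \<bullet> (x - y) + (1/2) * ((X *v (x - y)) \<bullet> (x - y))"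
    using ev
    by eventually_elim
       (simp add: Xmul inner_add_left dot_square_norm power2_eq_square[of "v \<bullet> _"] add_divide_distrib add.assoc)
  ultimately have "B \<le> (X *v (\<kappa> *\<^sub>R v)) \<bullet> (\<kappa> *\<^sub>R v)"
    using assms(1) unfolding touch_bound_def by blast
  also have "\<dots> = 2 * \<kappa>\<^sup>2 * (L * (norm v)\<^sup>2 + \<mu> * (norm v) ^ 4)"
  proof -
    have "norm v ^ 4 = (v \<bullet> v)\<^sup>2" by (simp add: power2_norm_eq_inner[symmetric])
    then show ?thesis
      unfolding power2_norm_eq_inner by (simp add: Xmul inner_add_left power2_eq_square algebra_simps)
  qed
  finally show ?thesis .
qed

section \<open>Comparison with radial functions in one more variable\<close>

text \<open>A radial profile \<phi> has infinity-Laplacian \<phi>'' \<phi>'^2, here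
  \<open>- k * (\<beta> - k * \<rho>)\<^sup>2\<close>. As \<open>W\<close> depends on the first
  component only, a test polynomial in \<open>x\<close> arises by choosing a suitable last
  coordinate for each \<open>x\<close>.\<close>

lemma radial_touching:
  fixes W :: "real^'n \<Rightarrow> real" and \<xi> :: "(real^'n) \<times> real"
  assumes tb: "touch_bound W (ctr + fst \<xi>) B"
    and "s > 0" and above: "\<And>\<zeta>. \<zeta> \<in> ball \<xi> s \<Longrightarrow>
          W (ctr + fst \<zeta>) + l * snd \<zeta> \<le> \<alpha> + \<beta> * norm \<zeta> - k * (norm \<zeta>)\<^sup>2 / 2"
    and eq: "W (ctr + fst \<xi>) + l * snd \<xi> = \<alpha> + \<beta> * norm \<xi> - k * (norm \<xi>)\<^sup>2 / 2"
    and "\<xi> \<noteq> 0" and l: "l\<^sup>2 = 1" and "\<beta> > 0"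
    and kB: "k > 0 \<or> B > 0"
  shows "B \<le> - k * (\<beta> - k * norm \<xi>)\<^sup>2"
proof -
  define v where "v = fst \<xi>"
  define z where "z = snd \<xi>"
  define \<rho> where "\<rho> = norm \<xi>"
  define g where "g = \<beta> - k * \<rho>"
  let ?y = "ctr + v"
  have \<xi>: "\<xi> = (v, z)" by (simp add: v_def z_def)
  have \<rho>0: "\<rho> > 0" using \<open>\<xi> \<noteq> 0\<close> by (simp add: \<rho>_def)
  have \<rho>2: "\<rho>\<^sup>2 = (norm v)\<^sup>2 + z\<^sup>2"
    by (simp add: \<rho>_def \<xi> norm_Pair)
  have Wy: "W ?y = \<alpha> - l * z + \<beta> * \<rho> - k * \<rho>\<^sup>2 / 2"
    using eq by (simp add: v_def z_def \<rho>_def)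
  show ?thesis
  proof (cases "v = 0")
    case True
    then have z0: "\<rho> = \<bar>z\<bar>" "z \<noteq> 0" using \<rho>2 \<rho>0 by (auto simp: power2_eq_iff_nonneg abs_le_square_iff power2_eq_iff)
    show ?thesis
    proof (cases "k > 0")
      case True
      \<comment> \<open>On the axis the left side is affine in the last coordinate, while the
        profile is strictly concave there; \<open>t < \<rho>\<close> keeps both points on the same
        side of the origin. Adding the two inequalities contradicts \<open>eq\<close>.\<close>
      define t where "t = min (s/2) (\<rho>/2)"
      have t: "t > 0" "t < s" "t < \<rho>" using \<open>s > 0\<close> \<rho>0 by (auto simp: t_def min_def)
      have b: "(0, z + t) \<in> ball \<xi> s" "(0, z - t) \<in> ball \<xi> s"
        using t \<open>v = 0\<close> by (auto simp: \<xi> dist_Pair_Pair dist_real_def)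
      have "\<bar>z + t\<bar> + \<bar>z - t\<bar> = 2 * \<rho>" using t z0 by linarith
      then have "\<beta> * \<bar>z + t\<bar> + \<beta> * \<bar>z - t\<bar> = \<beta> * (2 * \<rho>)" by (metis distrib_left)
      moreover have "k * t\<^sup>2 > 0" using True t by simp
      moreover have "(z + t)\<^sup>2 + (z - t)\<^sup>2 = 2 * \<rho>\<^sup>2 + 2 * t\<^sup>2"
        using z0 by (simp add: power2_eq_square algebra_simps)
      then have "k * (z + t)\<^sup>2 + k * (z - t)\<^sup>2 = k * (2 * \<rho>\<^sup>2 + 2 * t\<^sup>2)" by (metis distrib_left)
      moreover have "W ctr + l * (z + t) \<le> \<alpha> + \<beta> * \<bar>z + t\<bar> - k * (z + t)\<^sup>2 / 2"
        "W ctr + l * (z - t) \<le> \<alpha> + \<beta> * \<bar>z - t\<bar> - k * (z - t)\<^sup>2 / 2"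
        using above[OF b(1)] above[OF b(2)] by (simp_all add: norm_Pair)
      ultimately have False
        using Wy \<open>v = 0\<close> by (simp add: algebra_simps)
      then show ?thesis ..
    next
      case False
      \<comment> \<open>The test polynomial in \<open>x\<close> has zero gradient here, which forces
        \<open>B \<le> 0\<close>.\<close>
      then have "B > 0" using kB by simp
      have "\<forall>\<^sub>F x in at ?y. x \<in> ball ?y s"
        by (rule eventually_at_in_open') (use \<open>s > 0\<close> in auto)
      then have "\<forall>\<^sub>F x in at ?y. W x \<le> W ?y + 0 * (v \<bullet> (x - ?y)) + (\<beta> / \<rho> - k / 2) * (norm (x - ?y))\<^sup>2
                                + 0 * (v \<bullet> (x - ?y))\<^sup>2"
      proof eventually_elim
        case (elim x)
        define h where "h = x - ?y"
        have hb: "(h, z) \<in> ball \<xi> s"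
          using elim \<open>v = 0\<close> by (simp add: \<xi> dist_Pair_Pair h_def dist_norm norm_minus_commute)
        have n2: "(norm (h, z))\<^sup>2 = (norm h)\<^sup>2 + \<rho>\<^sup>2" using z0 by (simp add: norm_Pair)
        have "norm (h, z) \<le> \<rho> + (norm h)\<^sup>2 / \<rho>"
        proof (rule power2_le_imp_le)
          show "(norm (h, z))\<^sup>2 \<le> (\<rho> + (norm h)\<^sup>2 / \<rho>)\<^sup>2"
            unfolding n2 power2_sum using \<rho>0 by simp
        qed (use \<rho>0 in auto)
        then have "\<beta> * norm (h, z) \<le> \<beta> * (\<rho> + (norm h)\<^sup>2 / \<rho>)"
          using \<open>\<beta> > 0\<close> by simp
        then show ?case
          using above[OF hb] n2 Wy \<open>v = 0\<close> by (simp add: h_def algebra_simps add_divide_distrib)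
      qed
      from touch_boundD_rank_one[OF _ this, of B] tb \<open>B > 0\<close> show ?thesis by (simp add: v_def)
    qed
  next
    case False
    \<comment> \<open>Stationarity in the last coordinate: the profile has derivative
      \<open>g * z / \<rho>\<close> there, and the left side has derivative
      \<open>l\<close>.\<close>
    have zg: "g * z = l * \<rho>"
    proof -
      have sq: "sqrt ((norm v)\<^sup>2 + z\<^sup>2) = \<rho>" using \<rho>2 \<rho>0 by (metis less_imp_le real_sqrt_unique)
      have p: "(norm v)\<^sup>2 + z\<^sup>2 > 0" using \<rho>2 \<rho>0 by (metis zero_less_power)
      have "((\<lambda>t. \<beta> * sqrt ((norm v)\<^sup>2 + t\<^sup>2) - k * ((norm v)\<^sup>2 + t\<^sup>2) / 2 - l * t)
              has_real_derivative (\<beta> * (z / \<rho>) - k * z - l)) (at z)"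
        using p \<rho>0 by (auto intro!: derivative_eq_intros simp: sq) (simp add: field_simps)
      then have "\<beta> * (z / \<rho>) - k * z - l = 0"
      proof (rule DERIV_local_min)
        show "0 < s" by fact
        show "\<forall>t. \<bar>z - t\<bar> < s \<longrightarrow>
            \<beta> * sqrt ((norm v)\<^sup>2 + z\<^sup>2) - k * ((norm v)\<^sup>2 + z\<^sup>2) / 2 - l * z
            \<le> \<beta> * sqrt ((norm v)\<^sup>2 + t\<^sup>2) - k * ((norm v)\<^sup>2 + t\<^sup>2) / 2 - l * t"
        proof (intro allI impI)
          fix t assume "\<bar>z - t\<bar> < s"
          then have "(v, t) \<in> ball \<xi> s" by (simp add: \<xi> dist_Pair_Pair dist_real_def)
          from above[OF this] Wy
          show "\<beta> * sqrt ((norm v)\<^sup>2 + z\<^sup>2) - k * ((norm v)\<^sup>2 + z\<^sup>2) / 2 - l * z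
            \<le> \<beta> * sqrt ((norm v)\<^sup>2 + t\<^sup>2) - k * ((norm v)\<^sup>2 + t\<^sup>2) / 2 - l * t"
            unfolding sq \<rho>2[symmetric] using \<rho>0 by (simp add: norm_Pair)
        qed
      qed
      then have "(\<beta> * (z / \<rho>) - k * z - l) * \<rho> = 0" by simp
      then have "\<beta> * z - k * z * \<rho> - l * \<rho> = 0" using \<rho>0 by (simp add: left_diff_distrib)
      then show ?thesis by (simp add: g_def algebra_simps)
    qed
    define V where "V = (norm v)\<^sup>2"
    have V0: "V > 0" using False by (simp add: V_def)
    have slope_id: "g * \<rho> - l * z = g * V / \<rho>"
    proof -
      have "g * V = g * \<rho>\<^sup>2 - z * (g * z)" using \<rho>2 by (simp add: V_def power2_eq_square algebra_simps)
      also have "\<dots> = (g * \<rho> - l * z) * \<rho>" unfolding zg by (simp add: power2_eq_square algebra_simps)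
      finally show ?thesis using \<rho>0 by simp
    qed
    \<comment> \<open>Along \<open>P\<close> the distance to the centre is affine in the component of \<open>x - ?y\<close> parallel to \<open>v\<close>,
      up to a quadratic term in the orthogonal component, which the second derivative in the direction
      of the gradient does not see.\<close>
    define L where "L = \<beta> / \<rho> - k / 2"
    \<comment> \<open>With this choice \<open>L * V + \<mu> * V\<^sup>2\<close> equals
      \<open>- k * \<rho>\<^sup>2 / 2\<close>, so that only the radial second derivative
      \<open>- k\<close> survives in the direction of \<open>v\<close>.\<close>
    define \<mu> where "\<mu> = - L / V - k * \<rho>\<^sup>2 / (2 * V\<^sup>2)"
    have \<mu>V: "\<mu> * V\<^sup>2 = - L * V - k * \<rho>\<^sup>2 / 2"
      using V0 by (simp add: \<mu>_def left_diff_distrib power2_eq_square)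
    define c where "c x = (v \<bullet> (x - ?y)) / V" for x
    define P where "P x = (v + (x - ?y), z * (1 + c x))" for x
    have "(P \<longlongrightarrow> P ?y) (at ?y)" "(c \<longlongrightarrow> c ?y) (at ?y)"
      unfolding P_def c_def using V0 by (auto intro!: tendsto_eq_intros)
    moreover have "P ?y = \<xi>" "c ?y = 0" by (auto simp: P_def c_def \<xi>)
    ultimately have "(P \<longlongrightarrow> \<xi>) (at ?y)" "(c \<longlongrightarrow> 0) (at ?y)" by metis+
    then have "\<forall>\<^sub>F x in at ?y. P x \<in> ball \<xi> s" "\<forall>\<^sub>F x in at ?y. - (1/2) < c x"
      using \<open>s > 0\<close> by (simp_all add: tendstoD dist_commute[of \<xi>] order_tendstoD(1))
    then have "\<forall>\<^sub>F x in at ?y. W x \<le> W ?y + (g / \<rho>) * (v \<bullet> (x - ?y)) + L * (norm (x - ?y))\<^sup>2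
                                + \<mu> * (v \<bullet> (x - ?y))\<^sup>2"
    proof eventually_elim
      case (elim x)
      define h where "h = x - ?y"
      define C where "C = c x"
      have vh: "v \<bullet> h = C * V" using V0 by (simp add: C_def c_def h_def)
      define t where "t = (norm h)\<^sup>2 - C\<^sup>2 * V"
      have t0: "t \<ge> 0"
      proof -
        have "(v \<bullet> h)\<^sup>2 \<le> V * (norm h)\<^sup>2"
          unfolding V_def power2_norm_eq_inner by (rule Cauchy_Schwarz_ineq)
        then have "C\<^sup>2 * V \<le> (norm h)\<^sup>2"
          unfolding vh using V0 by (simp add: power2_eq_square)
        then show ?thesis by (simp add: t_def)
      qed
      have n2: "(norm (P x))\<^sup>2 = (1 + C)\<^sup>2 * \<rho>\<^sup>2 + t"
      proof -
        have "(norm (P x))\<^sup>2 = (norm (v + h))\<^sup>2 + (z * (1 + C))\<^sup>2"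
          by (simp add: P_def norm_Pair h_def C_def)
        also have "(norm (v + h))\<^sup>2 = V + 2 * (v \<bullet> h) + (norm h)\<^sup>2"
          unfolding V_def power2_norm_eq_inner by (simp add: inner_add_left inner_add_right inner_commute)
        finally show ?thesis
          unfolding vh \<rho>2 by (simp add: t_def V_def power2_eq_square algebra_simps)
      qed
      have C1: "1 + C > 1/2" using elim(2) by (simp add: C_def)
      \<comment> \<open>The square root lies below its tangent at
        \<open>((1 + C) * \<rho>)\<^sup>2\<close>, whose slope is at most \<open>1 / \<rho>\<close>
        because \<open>1 + C > 1/2\<close>. The loss affects only the orthogonal part
        \<open>t\<close>.\<close>
      have "norm (P x) \<le> (1 + C) * \<rho> + t / \<rho>"
      proof (rule power2_le_imp_le)
        have "t \<le> 2 * (1 + C) * t" using C1 t0 mult_right_mono[of 1 "2 * (1 + C)" t] by simp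
        also have "\<dots> = 2 * ((1 + C) * \<rho>) * (t / \<rho>)" using \<rho>0 by simp
        finally show "(norm (P x))\<^sup>2 \<le> ((1 + C) * \<rho> + t / \<rho>)\<^sup>2"
          unfolding n2 power2_sum[of "(1 + C) * \<rho>"] power_mult_distrib[of "1 + C" \<rho>] using zero_le_power2[of "t / \<rho>"] by linarith
        show "0 \<le> (1 + C) * \<rho> + t / \<rho>" using C1 t0 \<rho>0 by simp
      qed
      then have nle: "\<beta> * norm (P x) \<le> \<beta> * ((1 + C) * \<rho> + t / \<rho>)" using \<open>\<beta> > 0\<close> by simp
      have "ctr + fst (P x) = x" by (simp add: P_def)
      then have "W x + l * (z * (1 + C)) \<le> \<alpha> + \<beta> * norm (P x) - k * (norm (P x))\<^sup>2 / 2"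
        using above[OF elim(1)] by (simp add: P_def C_def)
      then have "W x \<le> \<alpha> - l * z * (1 + C) + \<beta> * ((1 + C) * \<rho> + t / \<rho>) - k * ((1 + C)\<^sup>2 * \<rho>\<^sup>2 + t) / 2"
        using nle n2 by simp
      also have "\<dots> = W ?y + C * (g * \<rho> - l * z) + L * t - k * \<rho>\<^sup>2 / 2 * C\<^sup>2"
      proof -
        have "\<beta> * (t / \<rho>) = \<beta> / \<rho> * t" by simp
        then show ?thesis
          unfolding Wy L_def g_def by (simp add: power2_eq_square algebra_simps)
      qed
      also have "\<dots> = W ?y + (g / \<rho>) * (C * V) + L * (norm h)\<^sup>2 + \<mu> * (C * V)\<^sup>2"
      proof -
        have "\<mu> * (C * V)\<^sup>2 = (\<mu> * V\<^sup>2) * C\<^sup>2" by (simp add: power_mult_distrib)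
        also have "\<dots> = - L * V * C\<^sup>2 - k * \<rho>\<^sup>2 / 2 * C\<^sup>2" unfolding \<mu>V by (simp add: left_diff_distrib)
        finally show ?thesis unfolding slope_id t_def by (simp add: algebra_simps)
      qed
      finally show ?case unfolding h_def[symmetric] vh .
    qed
    from touch_boundD_rank_one[OF _ this, of B] tb
    have "B \<le> 2 * (g / \<rho>)\<^sup>2 * (L * V + \<mu> * V\<^sup>2)" by (simp add: v_def V_def)
    also have "\<dots> = - k * g\<^sup>2"
      unfolding \<mu>V using \<rho>0 by (simp add: power_divide)
    finally show ?thesis by (simp add: g_def \<rho>_def)
  qed
qed

text \<open>If the maximum of the difference \<open>\<Psi>\<close> exceeded \<open>\<alpha>\<close>,
  it would lie neither on the sphere nor at the centre, where the profile has a conical point. A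
  vertical translate of the profile would then touch at an interior nonzero point, against
  \<open>strict\<close>.\<close>

lemma radial_comparison:
  fixes W :: "real^'n \<Rightarrow> real"
  assumes "r > 0" and cont: "continuous_on (cball ctr r) W"
    and tb: "\<And>y. y \<in> ball ctr r \<Longrightarrow> touch_bound W y B"
    and l: "l\<^sup>2 = 1"
    and "\<beta> > 0"
    and strict: "\<And>\<rho>. 0 < \<rho> \<Longrightarrow> \<rho> < r \<Longrightarrow> - k * (\<beta> - k * \<rho>)\<^sup>2 < B"
    and kB: "k > 0 \<or> B > 0"
    and center: "W ctr \<le> \<alpha>"
    and bdry: "\<And>\<zeta>. norm \<zeta> = r \<Longrightarrow> W (ctr + fst \<zeta>) + l * snd \<zeta> \<le> \<alpha> + \<beta> * r - k * r\<^sup>2 / 2"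
    and \<zeta>: "norm \<zeta> \<le> r"
  shows "W (ctr + fst \<zeta>) + l * snd \<zeta> \<le> \<alpha> + \<beta> * norm \<zeta> - k * (norm \<zeta>)\<^sup>2 / 2"
proof -
  define \<Psi> where "\<Psi> \<xi> = W (ctr + fst \<xi>) + l * snd \<xi> - (\<beta> * norm \<xi> - k * (norm \<xi>)\<^sup>2 / 2)" for \<xi>
  have fstb: "norm (fst \<xi>) \<le> norm \<xi>" for \<xi> :: "(real^'n) \<times> real"
    by (metis norm_fst_le prod.collapse)
  have "(\<lambda>\<xi>. ctr + fst \<xi>) ` cball (0 :: (real^'n) \<times> real) r \<subseteq> cball ctr r"
  proof (rule image_subsetI)
    fix \<xi> :: "(real^'n) \<times> real" assume "\<xi> \<in> cball 0 r"
    then show "ctr + fst \<xi> \<in> cball ctr r" using fstb[of \<xi>] by (simp add: dist_norm)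
  qed
  then have "continuous_on (cball 0 r) (\<lambda>\<xi> :: (real^'n) \<times> real. W (ctr + fst \<xi>))"
    by (intro continuous_on_compose2[OF cont] continuous_intros)
  then have "continuous_on (cball 0 r) \<Psi>"
    unfolding \<Psi>_def by (intro continuous_intros) auto
  moreover have "compact (cball (0 :: (real^'n) \<times> real) r)" "cball (0 :: (real^'n) \<times> real) r \<noteq> {}"
    using \<open>r > 0\<close> by auto
  ultimately obtain \<xi> where \<xi>: "norm \<xi> \<le> r" and max: "\<And>\<zeta>. norm \<zeta> \<le> r \<Longrightarrow> \<Psi> \<zeta> \<le> \<Psi> \<xi>"
    using continuous_attains_sup[of "cball 0 r" \<Psi>] by auto
  have "\<Psi> \<xi> \<le> \<alpha>"
  proof (rule ccontr)
    assume "\<not> \<Psi> \<xi> \<le> \<alpha>"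
    then have gt: "\<Psi> \<xi> > \<alpha>" by simp
    have "norm \<xi> \<noteq> r"
      using gt bdry[of \<xi>] by (auto simp: \<Psi>_def)
    with \<xi> have less: "norm \<xi> < r" by simp
    have "\<xi> \<noteq> 0"
      using gt center by (auto simp: \<Psi>_def)
    have "B \<le> - k * (\<beta> - k * norm \<xi>)\<^sup>2"
    proof (rule radial_touching[where W = W and ctr = ctr and l = l and s = "r - norm \<xi>" and \<alpha> = "\<Psi> \<xi>"])
      show "touch_bound W (ctr + fst \<xi>) B"
        by (rule tb) (use fstb[of \<xi>] less in \<open>simp add: dist_norm\<close>)
      show "W (ctr + fst \<zeta>) + l * snd \<zeta> \<le> \<Psi> \<xi> + \<beta> * norm \<zeta> - k * (norm \<zeta>)\<^sup>2 / 2"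
        if "\<zeta> \<in> ball \<xi> (r - norm \<xi>)" for \<zeta>
      proof -
        have "norm \<zeta> \<le> r"
          using that norm_triangle_ineq2[of \<zeta> \<xi>] by (simp add: dist_norm norm_minus_commute)
        from max[OF this] show ?thesis by (simp add: \<Psi>_def)
      qed
    qed (use \<open>\<beta> > 0\<close> less \<open>\<xi> \<noteq> 0\<close> l kB in \<open>simp_all add: \<Psi>_def\<close>)
    with strict[of "norm \<xi>"] less \<open>\<xi> \<noteq> 0\<close> show False by simp
  qed
  with max[OF \<zeta>] show ?thesis by (simp add: \<Psi>_def)
qed

section \<open>Increments over concentric balls\<close>

text \<open>
  The radial profiles used for \<open>w\<close> and \<open>V\<close> drop by \<open>q\<^sub>i * e + k\<^sub>i * e\<^sup>2 / 2\<close> over the flatter half of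
  \<open>[0, 2 e]\<close> and by \<open>q\<^sub>i * e + 3 * k\<^sub>i * e\<^sup>2 / 2\<close> over the steeper half.
\<close>

lemma slope_parameters:
  fixes a b q e :: real
  assumes "1 \<le> q" "0 < e" "0 < a" "a < b" "e * b \<le> 1/4" "20 * e * b\<^sup>2 \<le> b - a"
  obtains k1 k2 q1 q2 \<eta> where
    "\<eta> > 0" "k1 > 0" "k2 > 0" "q1 > 0" "q2 > 0"
    "a < k1 * q1\<^sup>2" "k2 * (q2 + 2 * k2 * e)\<^sup>2 < b"
    "q1 * e + k1 * e\<^sup>2 / 2 = q * e + \<eta>"
    "q2 * e + k2 * e\<^sup>2 / 2 = q * e - \<eta>"
    "q1 * e + 3 * k1 * e\<^sup>2 / 2 + 2 * \<eta> = q2 * e + 3 * k2 * e\<^sup>2 / 2"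
proof -
  \<comment> \<open>\<open>a1\<close> and \<open>b1\<close> cut the interval from \<open>a\<close>
    to \<open>b\<close> into thirds, and the curvatures are fixed by
    \<open>k1 * q\<^sup>2 = a1\<close> and \<open>k2 * q\<^sup>2 = b1\<close>. The outer thirds
    absorb the error of replacing the varying slope by \<open>q\<close>.\<close>
  define a1 where "a1 = a + (b - a) / 3"
  define b1 where "b1 = a + 2 * (b - a) / 3"
  have ab: "a < a1" "a1 < b1" "b1 < b" "0 < a1" "0 < b1"
    using assms by (auto simp: a1_def b1_def field_simps)
  define k1 where "k1 = a1 / q\<^sup>2"
  define k2 where "k2 = b1 / q\<^sup>2"
  have k: "0 < k1" "k1 < k2" using ab assms by (auto simp: k1_def k2_def divide_strict_right_mono)
  have q2: "1 \<le> q\<^sup>2" using assms by simp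
  have "k2 \<le> b1" unfolding k2_def using q2 ab by (simp add: divide_le_eq mult_le_cancel_left1)
  also have "b1 \<le> b1 * q" using assms ab by simp
  finally have k2b: "k2 \<le> b1 * q" .
  have "k1 \<le> a1" unfolding k1_def using q2 ab by (simp add: divide_le_eq mult_le_cancel_left1)
  also have "a1 \<le> a1 * q" using assms ab by simp
  finally have k1a: "k1 \<le> a1 * q" .
  \<comment> \<open>With \<open>\<eta> = \<gamma> * e\<close> the last equation reads
    \<open>(k2 - k1) * e\<^sup>2 = 4 * \<gamma> * e\<close>, hence the factor 1/4.\<close>
  define \<gamma> where "\<gamma> = (k2 - k1) * e / 4"
  have \<gamma>: "\<gamma> > 0" using k assms by (simp add: \<gamma>_def)
  define q1 where "q1 = q - k1 * e / 2 + \<gamma>"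
  define q2' where "q2' = q - k2 * e / 2 - \<gamma>"
  have eb: "e * b1 \<le> 1/4" "e * a1 \<le> 1/4"
    using assms ab by (smt (verit) mult_left_mono)+
  have k2e: "k2 * e \<le> q * (e * b1)" using k2b assms by (simp add: mult_ac)
  have k1e: "k1 * e \<le> q * (e * a1)" using k1a assms by (simp add: mult_ac)
  have "q * (e * b1) \<le> q / 4" using eb(1) assms by simp
  with k2e have k2q: "k2 * e \<le> q / 4" by simp
  have g4: "\<gamma> \<le> k2 * e / 4" using k assms by (simp add: \<gamma>_def)
  have lo: "q * (1 - e * a1 / 2) \<le> q1"
    using k1e \<gamma> by (simp add: q1_def algebra_simps)
  have up: "q2' + 2 * k2 * e \<le> q * (1 + 3 * (e * b1) / 2)"
    using k2e \<gamma> by (simp add: q2'_def algebra_simps)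
  show thesis
  proof
    show "\<gamma> * e > 0" "k1 > 0" "k2 > 0" using \<gamma> k assms by auto
    show "q1 * e + k1 * e\<^sup>2 / 2 = q * e + \<gamma> * e"
      by (simp add: q1_def power2_eq_square field_simps)
    show "q2' * e + k2 * e\<^sup>2 / 2 = q * e - \<gamma> * e"
      by (simp add: q2'_def power2_eq_square field_simps)
    show "q1 * e + 3 * k1 * e\<^sup>2 / 2 + 2 * (\<gamma> * e) = q2' * e + 3 * k2 * e\<^sup>2 / 2"
      by (simp add: q1_def q2'_def \<gamma>_def power2_eq_square field_simps)
    have pos: "0 < 1 - e * a1 / 2" using eb by simp
    show q1: "q1 > 0" using lo pos assms by (smt (verit) mult_pos_pos)
    show q2'0: "q2' > 0" using k2q g4 assms by (simp add: q2'_def)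
    have bb: "e * a1\<^sup>2 \<le> e * b\<^sup>2" "e * b1\<^sup>2 \<le> e * b\<^sup>2"
    proof -
      have "a1\<^sup>2 \<le> b\<^sup>2" "b1\<^sup>2 \<le> b\<^sup>2"
        using ab by (intro power_mono; linarith)+
      then show "e * a1\<^sup>2 \<le> e * b\<^sup>2" "e * b1\<^sup>2 \<le> e * b\<^sup>2"
        using assms(2) by simp_all
    qed
    have eb2: "20 * (e * b\<^sup>2) \<le> b - a" using assms(6) by (simp add: mult.assoc)
    have "a < a1 - e * a1\<^sup>2" using bb eb2 a1_def \<open>a < b\<close> by argo
    also have "\<dots> \<le> a1 * (1 - e * a1 / 2)\<^sup>2"
      using ab by (simp add: power2_eq_square algebra_simps)
    also have "\<dots> = k1 * (q * (1 - e * a1 / 2))\<^sup>2"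
      using assms by (simp add: k1_def power_mult_distrib)
    also have "\<dots> \<le> k1 * q1\<^sup>2"
      using lo pos assms k by (intro mult_left_mono power_mono) auto
    finally show "a < k1 * q1\<^sup>2" .
    have "k2 * (q2' + 2 * k2 * e)\<^sup>2 \<le> k2 * (q * (1 + 3 * (e * b1) / 2))\<^sup>2"
      using up q2'0 k assms by (intro mult_left_mono power_mono) auto
    also have "\<dots> = b1 * (1 + 3 * (e * b1) / 2)\<^sup>2"
      using assms by (simp add: k2_def power_mult_distrib)
    also have "\<dots> = b1 + 3 * (e * b1\<^sup>2) + 9 / 4 * (e * b1\<^sup>2) * (e * b1)"
      by (simp add: power2_eq_square field_simps)
    also have "\<dots> \<le> b1 + 3 * (e * b1\<^sup>2) + 9 / 4 * (e * b1\<^sup>2) * 1"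
      using eb assms by (intro add_left_mono mult_left_mono) auto
    also have "\<dots> < b" using bb eb2 b1_def \<open>a < b\<close> by argo
    finally show "k2 * (q2' + 2 * k2 * e)\<^sup>2 < b" .
  qed
qed

text \<open>Let A be the rise of \<open>W\<close> plus the last variable from the centre to
  \<open>\<xi>\<close>. By \<open>upper\<close> and \<open>lower\<close>, the further rise of
  \<open>W\<close> out to radius \<open>2 * e\<close> is at most \<open>d\<close> and the further
  drop of \<open>V\<close> is at most A. A concave profile for \<open>W\<close> gives A < d + k1 e^2
  + 2 \<eta>, a convex one for \<open>- V\<close> gives A > d + k2 e^2 - 2 \<eta>, and the two
  bounds coincide.\<close>

lemma no_common_extremum:
  fixes W V :: "real^'n \<Rightarrow> real" and \<xi> \<xi>' :: "(real^'n) \<times> real"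
  assumes "0 < e" "0 < a" "a < b" "e * b \<le> 1/4" "20 * e * b\<^sup>2 \<le> b - a"
    and contW: "continuous_on (cball x (2 * e)) W"
    and contV: "continuous_on (cball x (2 * e)) V"
    and sub: "\<And>y. y \<in> ball x (2 * e) \<Longrightarrow> touch_bound W y (- a)"
    and super: "\<And>y. y \<in> ball x (2 * e) \<Longrightarrow> touch_bound (\<lambda>z. - V z) y b"
    and \<xi>: "norm \<xi> \<le> e" and \<xi>': "norm \<xi>' \<le> e"
    and d: "d = V x - (V (x + fst \<xi>') + snd \<xi>')" and "e \<le> d"
    and upper: "\<And>\<zeta>. norm \<zeta> \<le> 2 * e \<Longrightarrow> W (x + fst \<zeta>) + snd \<zeta> \<le> W (x + fst \<xi>) + snd \<xi> + d"
    and lower: "\<And>\<zeta>. norm \<zeta> \<le> 2 * e \<Longrightarrow>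
       V (x + fst \<zeta>) + snd \<zeta> \<ge> V x - d - (W (x + fst \<xi>) + snd \<xi> - W x)"
  shows False
proof -
  define w where "w = W (x + fst \<xi>) + snd \<xi>"
  define v where "v = V (x + fst \<xi>') + snd \<xi>'"
  have "1 \<le> d / e" using assms by simp
  then obtain k1 k2 q1 q2 \<eta> where pos: "\<eta> > 0" "k1 > 0" "k2 > 0" "q1 > 0" "q2 > 0"
    and s1: "a < k1 * q1\<^sup>2" and s2: "k2 * (q2 + 2 * k2 * e)\<^sup>2 < b"
    and d1: "q1 * e + k1 * e\<^sup>2 / 2 = d / e * e + \<eta>"
    and d2: "q2 * e + k2 * e\<^sup>2 / 2 = d / e * e - \<eta>"
    and gap: "q1 * e + 3 * k1 * e\<^sup>2 / 2 + 2 * \<eta> = q2 * e + 3 * k2 * e\<^sup>2 / 2"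
    by (rule slope_parameters[OF _ assms(1-5)]) blast
  have de: "d / e * e = d" using \<open>0 < e\<close> by simp
  have e2: "0 < 2 * e" using \<open>0 < e\<close> by simp
  have W: "w - W x < q1 * e + 3 * k1 * e\<^sup>2 / 2 + \<eta>"
  proof (rule ccontr)
    assume neg: "\<not> ?thesis"
    \<comment> \<open>The profile has slope \<open>q1 + 2 * k1 * e\<close> at the centre and
      \<open>q1\<close> at radius \<open>2 * e\<close>. This \<open>\<alpha>\<close> puts its value
      at radius \<open>e\<close> at \<open>w - \<eta>\<close>, below the value attained at
      \<open>\<xi>\<close>.\<close>
    define \<alpha> where "\<alpha> = w - \<eta> - (q1 * e + 3 * k1 * e\<^sup>2 / 2)"
    have "W (x + fst \<xi>) + 1 * snd \<xi>
        \<le> \<alpha> + (q1 + 2 * k1 * e) * norm \<xi> - k1 * (norm \<xi>)\<^sup>2 / 2"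
    proof (rule radial_comparison[OF e2 contW sub])
      show "0 < q1 + 2 * k1 * e" using pos e2 by (simp add: add_pos_pos)
      show "- k1 * (q1 + 2 * k1 * e - k1 * \<rho>)\<^sup>2 < - a" if "0 < \<rho>" "\<rho> < 2 * e" for \<rho>
      proof -
        have "q1 \<le> q1 + 2 * k1 * e - k1 * \<rho>"
        proof -
          have "k1 * \<rho> \<le> k1 * (2 * e)" using that pos by simp
          also have "\<dots> = 2 * k1 * e" by simp
          finally show ?thesis by linarith
        qed
        then have "k1 * q1\<^sup>2 \<le> k1 * (q1 + 2 * k1 * e - k1 * \<rho>)\<^sup>2"
          using pos by (intro mult_left_mono power_mono) auto
        with s1 show ?thesis by simp
      qed
      show "W x \<le> \<alpha>" using neg by (simp add: \<alpha>_def)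
      show "W (x + fst \<zeta>) + 1 * snd \<zeta>
          \<le> \<alpha> + (q1 + 2 * k1 * e) * (2 * e) - k1 * (2 * e)\<^sup>2 / 2" if "norm \<zeta> = 2 * e" for \<zeta>
      proof -
        have "\<alpha> + (q1 + 2 * k1 * e) * (2 * e) - k1 * (2 * e)\<^sup>2 / 2 = w - \<eta> + (q1 * e + k1 * e\<^sup>2 / 2)"
          by (simp add: \<alpha>_def power2_eq_square algebra_simps)
        with upper[of \<zeta>] that d1 de show ?thesis by (simp add: w_def)
      qed
    qed (use pos \<xi> e2 in auto)
    also have "\<dots> \<le> \<alpha> + (q1 + 2 * k1 * e) * e - k1 * e\<^sup>2 / 2"
    proof -
      have "(e - norm \<xi>) * (q1 + 2 * k1 * e - k1 * (e + norm \<xi>) / 2) \<ge> 0"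
      proof (rule mult_nonneg_nonneg)
        have "k1 * (e + norm \<xi>) \<le> k1 * (2 * e)" using \<xi> pos by simp
        also have "\<dots> = 2 * k1 * e" by simp
        finally show "q1 + 2 * k1 * e - k1 * (e + norm \<xi>) / 2 \<ge> 0"
          using pos mult_pos_pos[OF \<open>k1 > 0\<close> \<open>0 < e\<close>] by linarith
      qed (use \<xi> in simp)
      then show ?thesis by (simp add: power2_eq_square algebra_simps diff_divide_distrib)
    qed
    also have "\<dots> = w - \<eta>" by (simp add: \<alpha>_def power2_eq_square algebra_simps)
    finally show False using pos by (simp add: w_def)
  qed
  have V: "w - W x > q2 * e + 3 * k2 * e\<^sup>2 / 2 - \<eta>"
  proof (rule ccontr)
    assume neg: "\<not> ?thesis"
    \<comment> \<open>The profile for \<open>- V\<close> is convex, starts at the central value with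
      slope \<open>q2\<close> and reaches \<open>- v - \<eta>\<close> at radius \<open>e\<close>.
      The last variable enters with sign -1.\<close>
    define \<alpha> where "\<alpha> = - V x"
    have "- V (x + fst \<xi>') + (-1) * snd \<xi>'
        \<le> \<alpha> + q2 * norm \<xi>' - (- k2) * (norm \<xi>')\<^sup>2 / 2"
    proof (rule radial_comparison[OF e2 continuous_on_minus[OF contV] super])
      show "- (- k2) * (q2 - (- k2) * \<rho>)\<^sup>2 < b" if "0 < \<rho>" "\<rho> < 2 * e" for \<rho>
      proof -
        have "k2 * (q2 + k2 * \<rho>)\<^sup>2 \<le> k2 * (q2 + 2 * k2 * e)\<^sup>2"
          using mult_left_mono[of \<rho> "2 * e" k2] that pos
          by (intro mult_left_mono power_mono) (auto simp: algebra_simps add_nonneg_nonneg)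
        with s2 show ?thesis by simp
      qed
      show "- V (x + fst \<zeta>) + (-1) * snd \<zeta>
          \<le> \<alpha> + q2 * (2 * e) - (- k2) * (2 * e)\<^sup>2 / 2" if "norm \<zeta> = 2 * e" for \<zeta>
      proof -
        have "\<alpha> + q2 * (2 * e) - (- k2) * (2 * e)\<^sup>2 / 2
            = \<alpha> + (q2 * e + k2 * e\<^sup>2 / 2) + (q2 * e + 3 * k2 * e\<^sup>2 / 2)"
          by (simp add: power2_eq_square algebra_simps)
        moreover have "V x - d - (w - W x) \<le> V (x + fst \<zeta>) + snd \<zeta>"
          using lower[of \<zeta>] that by (simp add: w_def)
        moreover have "q2 * e + k2 * e\<^sup>2 / 2 = d - \<eta>" using d2 de by simp
        ultimately show ?thesis using neg \<alpha>_def by linarith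
      qed
    qed (use pos \<xi>' e2 assms(2,3) in \<open>auto simp: \<alpha>_def\<close>)
    also have "\<dots> \<le> \<alpha> + q2 * e + k2 * e\<^sup>2 / 2"
    proof -
      have "q2 * norm \<xi>' \<le> q2 * e" "k2 * (norm \<xi>')\<^sup>2 \<le> k2 * e\<^sup>2"
        using \<xi>' pos by (auto intro!: power_mono)
      then show ?thesis by simp
    qed
    also have "\<dots> = - v - \<eta>" using d2 de d by (simp add: \<alpha>_def v_def)
    finally show False using pos by (simp add: v_def)
  qed
  show False using W V gap pos by linarith
qed

section \<open>Comparison for the elliptic equation\<close>

text \<open>The hypothesis \<open>off\<close> stands in for boundary values: any contact of
  \<open>w\<close> with a positive multiple of \<open>f\<close> lies in the compact set
  \<open>K\<close>, so small balls around it stay inside \<Omega>.\<close>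

lemma elliptic_comparison:
  fixes w f :: "real^'n \<Rightarrow> real"
  assumes "open \<Omega>" and K: "compact K" "K \<subseteq> \<Omega>"
    and contw: "continuous_on \<Omega> w" and contf: "continuous_on \<Omega> f"
    and f0: "\<And>x. x \<in> \<Omega> \<Longrightarrow> 0 < f x" and off: "\<And>x. x \<in> \<Omega> - K \<Longrightarrow> w x \<le> 0"
    and sub: "\<And>y. y \<in> \<Omega> \<Longrightarrow> 0 < w y \<Longrightarrow> touch_bound w y (- (w y / 2))"
    and super: "\<And>y. y \<in> \<Omega> \<Longrightarrow> touch_bound (\<lambda>x. - f x) y (f y / 2)"
    and "x \<in> \<Omega>"
  shows "w x \<le> f x"
proof (rule ccontr)
  assume "\<not> w x \<le> f x"
  then have "f x < w x" by simp
  with f0[OF \<open>x \<in> \<Omega>\<close>] off[of x] \<open>x \<in> \<Omega>\<close> have "x \<in> K" by fastforce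
  then have "K \<noteq> {}" by blast
  have "continuous_on K (\<lambda>y. w y / f y)"
    using K f0 by (intro continuous_intros continuous_on_subset[OF contw] continuous_on_subset[OF contf]) force+
  then obtain x0 where x0: "x0 \<in> K" and max0: "\<And>y. y \<in> K \<Longrightarrow> w y / f y \<le> w x0 / f x0"
    using continuous_attains_sup[OF K(1) \<open>K \<noteq> {}\<close>] by blast
  define \<theta> where "\<theta> = w x0 / f x0"
  define V where "V y = \<theta> * f y" for y
  have "1 < w x / f x" using \<open>f x < w x\<close> f0[OF \<open>x \<in> \<Omega>\<close>] by simp
  with max0[OF \<open>x \<in> K\<close>] have \<theta>: "1 < \<theta>" by (simp add: \<theta>_def)
  have V0: "0 < V y" if "y \<in> \<Omega>" for y using f0[OF that] \<theta> by (simp add: V_def)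
  have wV: "w y \<le> V y" if "y \<in> \<Omega>" for y
  proof (cases "y \<in> K")
    case True
    then show ?thesis using max0[OF True] f0[OF that] by (simp add: V_def \<theta>_def divide_le_eq)
  next
    case False
    then show ?thesis using off[of y] V0[OF that] that by simp
  qed
  have wV0: "w x0 = V x0"
    using f0[of x0] x0 K by (auto simp: V_def \<theta>_def)
  have contV: "continuous_on \<Omega> V"
    unfolding V_def by (intro continuous_intros contf)

  obtain \<delta> where "\<delta> > 0" and ball_sub: "(\<Union>y\<in>K. ball y (3 * \<delta>)) \<subseteq> \<Omega>"
  proof -
    obtain r where "r > 0" "(\<Union>y\<in>K. ball y r) \<subseteq> \<Omega>"
      using compact_subset_open_imp_ball_epsilon_subset[OF K(1) \<open>open \<Omega>\<close> K(2)] by blast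
    then show thesis using that[of "r / 3"] by simp
  qed
  \<comment> \<open>Centres of balls range over \<open>K1\<close> and points of the balls over
    \<open>L\<close>. The margin lets a centre in \<open>K\<close> be displaced by up to \<delta>
    within \<open>K1\<close>.\<close>
  define K1 where "K1 = {y. infdist y K \<le> \<delta>}"
  define L where "L = {y. infdist y K \<le> 2 * \<delta>}"
  have comp: "compact K1" "compact L"
    unfolding K1_def L_def using compact_infdist_le[OF \<open>K \<noteq> {}\<close> K(1)] \<open>\<delta> > 0\<close> by auto
  have infK: "infdist z K \<le> dist y z" if "y \<in> K" for y z
    using infdist_le[OF that, of z] by (simp add: dist_commute)
  have K1: "z \<in> K1" if "y \<in> K" "dist y z \<le> \<delta>" for y z
    using infK[OF that(1), of z] that(2) by (simp add: K1_def)
  have L: "z \<in> L" if "y \<in> K" "dist y z \<le> 2 * \<delta>" for y z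
    using infK[OF that(1), of z] that(2) by (simp add: L_def)
  have K1L: "y + h \<in> L" if "y \<in> K1" "norm h \<le> \<delta>" for y h
    using infdist_triangle[of "y + h" K y] that by (simp add: K1_def L_def dist_norm)
  have "L \<subseteq> \<Omega>"
  proof
    fix z assume "z \<in> L"
    obtain y where "y \<in> K" "infdist z K = dist z y"
      using infdist_attains_inf[OF compact_imp_closed[OF K(1)] \<open>K \<noteq> {}\<close>, of z] by blast
    then have "z \<in> ball y (3 * \<delta>)"
      using \<open>z \<in> L\<close> \<open>\<delta> > 0\<close> by (simp add: L_def dist_commute)
    then show "z \<in> \<Omega>" using ball_sub \<open>y \<in> K\<close> by blast
  qed
  have "x0 \<in> L" using L[OF x0, of x0] \<open>\<delta> > 0\<close> by simp
  have contL: "continuous_on L w" "continuous_on L V"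
    using contw contV \<open>L \<subseteq> \<Omega>\<close> continuous_on_subset by blast+
  have "L \<noteq> {}" using \<open>x0 \<in> L\<close> by blast
  obtain \<mu> where "\<mu> > 0" and \<mu>: "\<And>y. y \<in> L \<Longrightarrow> \<mu> \<le> V y"
    using continuous_attains_inf[OF comp(2) \<open>L \<noteq> {}\<close> contL(2)] V0 \<open>L \<subseteq> \<Omega>\<close> by blast
  obtain M where M: "\<And>y. y \<in> L \<Longrightarrow> V y \<le> M"
    using continuous_attains_sup[OF comp(2) \<open>L \<noteq> {}\<close> contL(2)] by blast
  have "M > 0" using M[OF \<open>x0 \<in> L\<close>] \<mu>[OF \<open>x0 \<in> L\<close>] \<open>\<mu> > 0\<close> by simp
  define \<kappa> where "\<kappa> = \<theta>\<^sup>2"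
  have \<kappa>: "\<kappa> > 1" using \<theta> by (simp add: \<kappa>_def)
  \<comment> \<open>\<open>\<tau>\<close> is the oscillation allowed on a ball of radius
    \<open>2 * e\<close>: the first entry will keep \<open>w c\<close> positive, the second will
    keep \<open>b - a\<close> at least \<open>\<gamma>\<close>.\<close>
  define \<tau> where "\<tau> = min (\<mu> / 6) ((\<kappa> - 1) * \<mu> / (2 * (\<kappa> + 1)))"
  have \<tau>: "\<tau> > 0" "6 * \<tau> \<le> \<mu>" "(\<kappa> + 1) * \<tau> \<le> (\<kappa> - 1) * \<mu> / 2"
  proof -
    show "\<tau> > 0" "6 * \<tau> \<le> \<mu>" using \<kappa> \<open>\<mu> > 0\<close> by (auto simp: \<tau>_def)
    have "(\<kappa> + 1) * \<tau> \<le> (\<kappa> + 1) * ((\<kappa> - 1) * \<mu> / (2 * (\<kappa> + 1)))"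
      using \<kappa> by (intro mult_left_mono) (auto simp: \<tau>_def)
    also have "\<dots> = (\<kappa> - 1) * \<mu> / 2" using \<kappa> by (simp add: field_simps)
    finally show "(\<kappa> + 1) * \<tau> \<le> (\<kappa> - 1) * \<mu> / 2" .
  qed
  have unif: "\<exists>\<eta>>0. \<forall>y\<in>L. \<forall>z\<in>L. dist z y < \<eta> \<longrightarrow> \<bar>g z - g y\<bar> < \<tau>"
    if "continuous_on L g" for g :: "real^'n \<Rightarrow> real"
    using compact_uniformly_continuous[OF that comp(2)] \<tau>(1)
    unfolding uniformly_continuous_on_def dist_real_def by blast
  obtain \<eta>1 where "\<eta>1 > 0"
    and \<eta>1: "\<And>y z. y \<in> L \<Longrightarrow> z \<in> L \<Longrightarrow> dist z y < \<eta>1 \<Longrightarrow> \<bar>w z - w y\<bar> < \<tau>"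
    using unif[OF contL(1)] by blast
  obtain \<eta>2 where "\<eta>2 > 0"
    and \<eta>2: "\<And>y z. y \<in> L \<Longrightarrow> z \<in> L \<Longrightarrow> dist z y < \<eta>2 \<Longrightarrow> \<bar>V z - V y\<bar> < \<tau>"
    using unif[OF contL(2)] by blast
  define bM where "bM = \<kappa> * M / 2"
  have bM: "bM > 0" using \<kappa> \<open>M > 0\<close> by (simp add: bM_def)
  define \<gamma> where "\<gamma> = (\<kappa> - 1) * \<mu> / 4"
  have \<gamma>: "\<gamma> > 0" using \<kappa> \<open>\<mu> > 0\<close> by (simp add: \<gamma>_def)
  \<comment> \<open>\<open>\<delta>\<close> keeps the balls in \<open>L\<close>,
    \<open>\<tau>\<close> bounds the last coordinates, \<open>\<eta>1\<close> and
    \<open>\<eta>2\<close> give the oscillation bounds, and the last two entries are the smallness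
    conditions of \<open>no_common_extremum\<close>.\<close>
  define e where "e = Min {\<delta>, \<tau>, \<eta>1 / 3, \<eta>2 / 3, 1 / (4 * bM), \<gamma> / (20 * bM\<^sup>2)}"
  have e: "e > 0" "e \<le> \<delta>" "e \<le> \<tau>" "2 * e < \<eta>1" "2 * e < \<eta>2"
    and ebM: "e \<le> 1 / (4 * bM)" "e \<le> \<gamma> / (20 * bM\<^sup>2)"
    using \<open>\<delta> > 0\<close> \<open>\<eta>1 > 0\<close> \<open>\<eta>2 > 0\<close> \<tau>(1) bM \<gamma> by (auto simp: e_def)
  have ebM1: "e * bM \<le> 1 / 4" "20 * e * bM\<^sup>2 \<le> \<gamma>"
    using ebM bM by (auto simp: field_simps)

  \<comment> \<open>For fixed \<open>y\<close>, maximising over both offsets yields the maximum of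
    \<open>w\<close> minus the minimum of \<open>V\<close> over a ball around \<open>y\<close>, each
    with the last variable added.\<close>
  define J where "J y \<zeta> \<zeta>' = w (y + fst \<zeta>) + snd \<zeta> - (V (y + fst \<zeta>') + snd \<zeta>')"
    for y and \<zeta> \<zeta>' :: "(real^'n) \<times> real"
  have fstb: "norm (fst \<zeta>) \<le> norm \<zeta>" "\<bar>snd \<zeta>\<bar> \<le> norm \<zeta>" for \<zeta> :: "(real^'n) \<times> real"
    by (metis norm_fst_le prod.collapse) (metis norm_snd_le prod.collapse real_norm_def)
  define T where "T = K1 \<times> cball (0 :: (real^'n) \<times> real) e \<times> cball (0 :: (real^'n) \<times> real) e"
  have "compact T" unfolding T_def by (intro compact_Times comp compact_cball)
  moreover have "(x0, 0, 0) \<in> T"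
    using K1[OF x0, of x0] \<open>\<delta> > 0\<close> e by (simp add: T_def)
  then have "T \<noteq> {}" by blast
  moreover have contJ: "continuous_on T (\<lambda>p. J (fst p) (fst (snd p)) (snd (snd p)))"
  proof -
    have "(\<lambda>p. fst p + fst (fst (snd p))) ` T \<subseteq> L" "(\<lambda>p. fst p + fst (snd (snd p))) ` T \<subseteq> L"
      unfolding T_def using order_trans[OF order_trans[OF fstb(1)] e(2)]
      by (auto intro!: K1L simp del: split_paired_All)
    then have "continuous_on T (\<lambda>p. w (fst p + fst (fst (snd p))))"
      "continuous_on T (\<lambda>p. V (fst p + fst (snd (snd p))))"
      by (auto intro!: continuous_on_compose2[OF contL(1)] continuous_on_compose2[OF contL(2)] continuous_intros)
    then show ?thesis unfolding J_def by (intro continuous_intros)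
  qed
  ultimately obtain p where "p \<in> T"
    and pmax: "\<And>p'. p' \<in> T \<Longrightarrow> J (fst p') (fst (snd p')) (snd (snd p')) \<le> J (fst p) (fst (snd p)) (snd (snd p))"
    using continuous_attains_sup[OF _ _ contJ] by blast
  obtain c \<xi> \<xi>' where p: "p = (c, \<xi>, \<xi>')" by (metis prod_cases3)
  have c: "c \<in> K1" and \<xi>: "norm \<xi> \<le> e" "norm \<xi>' \<le> e" using \<open>p \<in> T\<close> by (auto simp: p T_def)
  have Jmax: "J y \<zeta> \<zeta>' \<le> J c \<xi> \<xi>'" if "y \<in> K1" "norm \<zeta> \<le> e" "norm \<zeta>' \<le> e" for y \<zeta> \<zeta>'
    using pmax[of "(y, \<zeta>, \<zeta>')"] that by (simp add: p T_def)

  have "c \<in> L" using K1L[OF c, of 0] \<open>\<delta> > 0\<close> by simp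
  then have "c \<in> \<Omega>" using \<open>L \<subseteq> \<Omega>\<close> by blast
  define m where "m = V c"
  have m: "\<mu> \<le> m" "m \<le> M" using \<mu> M \<open>c \<in> L\<close> by (auto simp: m_def)
  \<comment> \<open>The contact point \<open>x0\<close> with zero offsets shows that the maximum is
    nonnegative; two oscillations and two last coordinates cost at most \<open>\<tau>\<close>
    each.\<close>
  have wc: "m - 4 * \<tau> \<le> w c"
  proof -
    have "0 \<le> J c \<xi> \<xi>'"
      using Jmax[of x0 0 0] K1[OF x0, of x0] \<open>\<delta> > 0\<close> e wV0 by (simp add: J_def)
    moreover have "\<bar>w (c + fst \<xi>) - w c\<bar> < \<tau>" "\<bar>V (c + fst \<xi>') - V c\<bar> < \<tau>"
      using \<open>c \<in> L\<close> K1L[OF c, of "fst \<xi>"] K1L[OF c, of "fst \<xi>'"] fstb(1)[of \<xi>] fstb(1)[of \<xi>'] \<xi> e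
      by (auto intro!: \<eta>1 \<eta>2 simp: dist_norm)
    ultimately show ?thesis
      using fstb(2)[of \<xi>] fstb(2)[of \<xi>'] \<xi> e by (simp add: J_def m_def)
  qed
  then have "w c > 0" using \<tau> m \<open>\<mu> > 0\<close> by linarith
  \<comment> \<open>Positivity of \<open>w\<close> brings the maximising centre back into
    \<open>K\<close>, so that it may be moved in every direction within \<open>K1\<close>.\<close>
  then have "c \<in> K" using off[of c] \<open>c \<in> \<Omega>\<close> by fastforce
  have cbL: "cball c (2 * e) \<subseteq> L" using L[OF \<open>c \<in> K\<close>] e by auto

  \<comment> \<open>On the ball of radius \<open>2 * e\<close> around \<open>c\<close>,
    \<open>a\<close> bounds \<open>w / 2\<close> from above and \<open>b\<close> bounds
    \<open>\<kappa> * V / 2\<close> from below.\<close>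
  define a where "a = (m + \<tau>) / 2"
  define b where "b = \<kappa> * (m - \<tau>) / 2"
  have ba: "\<gamma> \<le> b - a"
  proof -
    have "(\<kappa> - 1) * \<mu> \<le> (\<kappa> - 1) * m" using m \<kappa> by simp
    then show ?thesis using \<tau>(3) by (simp add: a_def b_def \<gamma>_def field_simps)
  qed
  have "b \<le> bM"
    using m \<kappa> \<tau> by (simp add: b_def bM_def mult_left_mono)
  have "0 < a" using m \<open>\<mu> > 0\<close> \<tau> by (simp add: a_def)
  have "0 < b" using ba \<gamma> \<open>0 < a\<close> by simp
  show False
  proof (rule no_common_extremum[where e = e and a = a and b = b and W = w and V = V and x = c
        and \<xi> = \<xi> and \<xi>' = \<xi>' and d = "V c - (V (c + fst \<xi>') + snd \<xi>')"])
    show "0 < e" "0 < a" "a < b" using e \<open>0 < a\<close> ba \<gamma> by auto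
    have "e * b \<le> e * bM" using \<open>b \<le> bM\<close> e(1) by simp
    then show "e * b \<le> 1/4" using ebM1(1) by linarith
    have "b\<^sup>2 \<le> bM\<^sup>2" using \<open>b \<le> bM\<close> \<open>0 < b\<close> by (intro power_mono) auto
    then have "20 * e * b\<^sup>2 \<le> 20 * e * bM\<^sup>2" using e(1) by simp
    then show "20 * e * b\<^sup>2 \<le> b - a" using ebM1(2) ba by linarith
    show "continuous_on (cball c (2 * e)) w" "continuous_on (cball c (2 * e)) V"
      using contL cbL continuous_on_subset by blast+
    show "norm \<xi> \<le> e" "norm \<xi>' \<le> e" by fact+
    show "touch_bound w y (- a)" if "y \<in> ball c (2 * e)" for y
    proof -
      have "y \<in> L" using cbL that by auto
      have "\<bar>w y - w c\<bar> < \<tau>"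
        using that e by (intro \<eta>1[OF \<open>c \<in> L\<close> \<open>y \<in> L\<close>]) (simp add: dist_commute)
      moreover have "w c \<le> m" using wV[OF \<open>c \<in> \<Omega>\<close>] by (simp add: m_def)
      ultimately have "0 < w y" "w y \<le> m + \<tau>" using wc m \<tau> by linarith+
      moreover from this have "touch_bound w y (- (w y / 2))"
        using sub \<open>y \<in> L\<close> \<open>L \<subseteq> \<Omega>\<close> by blast
      ultimately show ?thesis
        by (elim touch_bound_mono) (simp add: a_def)
    qed
    show "touch_bound (\<lambda>z. - V z) y b" if "y \<in> ball c (2 * e)" for y
    proof -
      have "y \<in> L" using cbL that by auto
      have "\<bar>V y - V c\<bar> < \<tau>"
        using that e by (intro \<eta>2[OF \<open>c \<in> L\<close> \<open>y \<in> L\<close>]) (simp add: dist_commute)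
      then have "\<kappa> * (m - \<tau>) \<le> \<kappa> * V y" using \<kappa> by (intro mult_left_mono) (auto simp: m_def)
      also have "\<kappa> * V y = 2 * (\<theta> ^ 3 * (f y / 2))"
        by (simp add: \<kappa>_def V_def power2_eq_square power3_eq_cube)
      finally have "b \<le> \<theta> ^ 3 * (f y / 2)" by (simp add: b_def)
      moreover have "touch_bound (\<lambda>z. \<theta> * - f z) y (\<theta> ^ 3 * (f y / 2))"
        using \<open>y \<in> L\<close> \<open>L \<subseteq> \<Omega>\<close> \<theta> by (intro touch_bound_scale super) auto
      then have "touch_bound (\<lambda>z. - V z) y (\<theta> ^ 3 * (f y / 2))" by (simp add: V_def)
      ultimately show ?thesis using touch_bound_mono by blast
    qed
    \<comment> \<open>The offset \<open>(0, - e)\<close> lowers \<open>V\<close> plus the last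
      variable by exactly \<open>e\<close>. This makes the slope \<open>d / e\<close> at least
      1.\<close>
    show "e \<le> V c - (V (c + fst \<xi>') + snd \<xi>')"
      using Jmax[OF c \<xi>(1), of "(0, - e)"] e by (simp add: J_def norm_Pair)
    fix \<zeta> :: "(real^'n) \<times> real" assume \<zeta>: "norm \<zeta> \<le> 2 * e"
    \<comment> \<open>Every point of the ball of radius \<open>2 e\<close> about \<open>c\<close> lies, together with \<open>c\<close>, in a ball of radius \<open>e\<close>.\<close>
    define R where "R = (1/2) *\<^sub>R \<zeta>"
    have R: "norm R \<le> e" "norm (- R) \<le> e" using \<zeta> by (auto simp: R_def)
    have cR: "c + fst R \<in> K1"
      using K1[OF \<open>c \<in> K\<close>, of "c + fst R"] fstb(1)[of R] R e by (simp add: dist_norm)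
    have RR: "c + fst R + fst R = c + fst \<zeta>" "snd R = snd \<zeta> / 2"
      by (simp_all add: R_def scaleR_half_double add.assoc)
    \<comment> \<open>From the centre \<open>c + fst R\<close>, the offset \<open>R\<close> leads to
      \<open>c + fst \<zeta>\<close> and \<open>- R\<close> back to \<open>c\<close>; each
      contributes half of \<open>snd \<zeta>\<close>. Exchanging the offsets gives the bound for
      \<open>V\<close>.\<close>
    show "w (c + fst \<zeta>) + snd \<zeta> \<le> w (c + fst \<xi>) + snd \<xi> + (V c - (V (c + fst \<xi>') + snd \<xi>'))"
      using Jmax[OF cR R(1) R(2)] by (simp add: J_def RR)
    show "V c - (V c - (V (c + fst \<xi>') + snd \<xi>')) - (w (c + fst \<xi>) + snd \<xi> - w c) \<le> V (c + fst \<zeta>) + snd \<zeta>"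
      using Jmax[OF cR R(2) R(1)] by (simp add: J_def RR)
  qed simp
qed

section \<open>Elimination of time and passage from jets to touching bounds\<close>

lemma SUP_compact_attained:
  fixes F :: "real \<Rightarrow> 'a::metric_space \<Rightarrow> real"
  assumes "compact I" "I \<noteq> {}" and cont: "continuous_on (I \<times> C) (\<lambda>z. F (fst z) (snd z))" and "x \<in> C"
  obtains t where "t \<in> I" "(SUP s\<in>I. F s x) = F t x" "\<And>s. s \<in> I \<Longrightarrow> F s x \<le> F t x"
proof -
  have "continuous_on I (\<lambda>t. F t x)"
    using \<open>x \<in> C\<close> by (intro continuous_on_compose2[OF cont, of I "\<lambda>t. (t, x)", simplified] continuous_intros) auto
  then obtain t where t: "t \<in> I" "\<forall>s\<in>I. F s x \<le> F t x"
    using continuous_attains_sup[OF assms(1,2)] by blast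
  then have "(SUP s\<in>I. F s x) = F t x" by (intro cSup_eq_maximum) auto
  with t that show thesis by blast
qed

text \<open>A maximising parameter for one point is a competitor for the other, and uniform
  continuity on the compact product controls the difference.\<close>

lemma continuous_on_SUP_compact:
  fixes F :: "real \<Rightarrow> 'a::metric_space \<Rightarrow> real"
  assumes "compact I" "I \<noteq> {}" "compact C" and cont: "continuous_on (I \<times> C) (\<lambda>z. F (fst z) (snd z))"
  shows "continuous_on C (\<lambda>x. SUP t\<in>I. F t x)"
  unfolding continuous_on_iff
proof (intro ballI allI impI)
  fix x and \<epsilon> :: real assume "x \<in> C" "\<epsilon> > 0"
  have "uniformly_continuous_on (I \<times> C) (\<lambda>z. F (fst z) (snd z))"
    using assms by (intro compact_uniformly_continuous compact_Times)
  then obtain \<delta> where "\<delta> > 0" and \<delta>: "\<forall>z\<in>I \<times> C. \<forall>z'\<in>I \<times> C. dist z' z < \<delta> \<longrightarrow>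
      dist (F (fst z') (snd z')) (F (fst z) (snd z)) < \<epsilon>"
    unfolding uniformly_continuous_on_def using \<open>\<epsilon> > 0\<close> by blast
  have less: "(SUP t\<in>I. F t a) < (SUP t\<in>I. F t b) + \<epsilon>" if "a \<in> C" "b \<in> C" "dist a b < \<delta>" for a b
  proof -
    obtain t where t: "t \<in> I" "(SUP s\<in>I. F s a) = F t a"
      using SUP_compact_attained[OF assms(1,2,4) \<open>a \<in> C\<close>] by metis
    obtain t' where t': "t' \<in> I" "(SUP s\<in>I. F s b) = F t' b" "F t b \<le> F t' b"
      using SUP_compact_attained[OF assms(1,2,4) \<open>b \<in> C\<close>] t(1) by metis
    have "dist (F t a) (F t b) < \<epsilon>"
      using bspec[OF bspec[OF \<delta>, of "(t, b)"], of "(t, a)"] t(1) that by (simp add: dist_Pair_Pair)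
    then show ?thesis using t t' by (simp add: dist_real_def)
  qed
  show "\<exists>d>0. \<forall>x'\<in>C. dist x' x < d \<longrightarrow> dist (SUP t\<in>I. F t x') (SUP t\<in>I. F t x) < \<epsilon>"
  proof (intro exI[of _ \<delta>] conjI ballI impI)
    fix x' assume x': "x' \<in> C" "dist x' x < \<delta>"
    have "(SUP t\<in>I. F t x') < (SUP t\<in>I. F t x) + \<epsilon>" "(SUP t\<in>I. F t x) < (SUP t\<in>I. F t x') + \<epsilon>"
      using less[of x' x] less[of x x'] x' \<open>x \<in> C\<close> by (auto simp: dist_commute)
    then show "dist (SUP t\<in>I. F t x') (SUP t\<in>I. F t x) < \<epsilon>" by (simp add: dist_real_def)
  qed fact
qed

text \<open>If \<open>w y + P x\<close> touches \<open>w\<close> from above at \<open>y\<close>,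
  then \<open>(w y + P x) / g T t\<close> touches \<open>u - e\<close> from above at
  \<open>(t0, y)\<close>. The derivative of \<open>1 / g T\<close> carries the factor
  \<open>(1 / g T t0) ^ 3\<close>, which is also the factor produced by the cubic homogeneity, so it
  cancels.\<close>

lemma touch_bound_time_max:
  fixes u :: "real \<times> (real^'n) \<Rightarrow> real" and w :: "real^'n \<Rightarrow> real"
  defines "g \<equiv> \<lambda>T t. sqrt (t - t\<^sup>2 / T)"
  assumes t0: "0 < t0" "t0 < T" and "w y \<ge> 0"
    and sub: "\<And>s p X. (s, p, X) \<in> par_superjet u (t0, y) \<Longrightarrow> s - (X *v p) \<bullet> p \<le> 0"
    and eq: "w y = g T t0 * (u (t0, y) - e)"
    and le: "\<forall>\<^sub>F z in nhds (t0, y). g T (fst z) * (u z - e) \<le> w (snd z)"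
  shows "touch_bound w y (- (w y / 2))"
  unfolding touch_bound_def
proof (intro allI impI)
  fix p :: "real^'n" and X :: "real^'n^'n"
  assume X: "transpose X = X"
    and ev: "\<forall>\<^sub>F x in at y. w x \<le> w y + p \<bullet> (x - y) + (1/2) * ((X *v (x - y)) \<bullet> (x - y))"
  define P where "P x = p \<bullet> (x - y) + (1/2) * ((X *v (x - y)) \<bullet> (x - y))" for x
  have "\<forall>\<^sub>F x in nhds y. w x \<le> w y + P x"
    using ev unfolding eventually_nhds_conv_at by (simp add: P_def add.assoc)
  define \<gamma> where "\<gamma> t = 1 / g T t" for t
  define h' where "h' = 1 - 2 * t0 / T"
  define \<gamma>1 where "\<gamma>1 = - (1/2) * \<gamma> t0 ^ 3 * h'"
  have pos: "0 < t - t\<^sup>2 / T" if "0 < t" "t < T" for t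
    using that by (simp add: power2_eq_square field_simps)
  have \<gamma>0: "\<gamma> t0 > 0" using pos[OF t0] by (simp add: \<gamma>_def g_def)
  have deriv: "(\<gamma> has_real_derivative \<gamma>1) (at t0)"
  proof -
    define q where "q = sqrt (t0 - t0\<^sup>2 / T)"
    have q: "q > 0" using pos[OF t0] by (simp add: q_def)
    have "((\<lambda>t. 1 / sqrt (t - t\<^sup>2 / T)) has_real_derivative
            - (inverse q / 2 * (1 - 2 * t0 / T)) / (q * q)) (at t0)"
      using pos[OF t0] t0 q unfolding q_def by (auto intro!: derivative_eq_intros)
    moreover have "- (inverse q / 2 * (1 - 2 * t0 / T)) / (q * q) = \<gamma>1"
      using q by (simp add: \<gamma>1_def \<gamma>_def g_def q_def[symmetric] h'_def power3_eq_cube field_simps)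
    ultimately show ?thesis unfolding \<gamma>_def g_def by simp
  qed
  have taylor: "\<forall>\<^sub>F t in nhds t0. \<bar>\<gamma> t - \<gamma> t0 - \<gamma>1 * (t - t0)\<bar> \<le> c * \<bar>t - t0\<bar>" if "c > 0" for c
    using deriv that unfolding has_field_derivative_def has_derivative_within_alt2 eventually_nhds_conv_at by simp
  have limt: "filterlim fst (nhds t0) (at (t0, y))" and limx: "filterlim snd (nhds y) (at (t0, y))"
    using tendsto_fst[OF tendsto_ident_at, of "(t0, y)"] tendsto_snd[OF tendsto_ident_at, of "(t0, y)"] by simp_all
  \<comment> \<open>This is what remains of \<open>\<gamma> t * (w y + P x)\<close> after the jet
    terms: a first-order Taylor error in time, and a product of \<open>P x\<close>, which tends to
    0, with a term of order \<open>\<bar>t - t0\<bar>\<close>.\<close>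
  define r where "r = (\<lambda>(t, x). w y * (\<gamma> t - \<gamma> t0 - \<gamma>1 * (t - t0)) + P x * (\<gamma> t - \<gamma> t0))"
  have "(P \<longlongrightarrow> P y) (nhds y)"
    unfolding P_def by (intro tendsto_intros bounded_linear.tendsto[OF matrix_vector_mul_bounded_linear] filterlim_ident)
  then have P0: "(P \<longlongrightarrow> 0) (nhds y)" by (simp add: P_def)
  have "r \<in> o[at (t0, y)](\<lambda>(t, x). \<bar>t - t0\<bar> + (norm (x - y))\<^sup>2)"
  proof (rule landau_o.smallI)
    fix c :: real assume "c > 0"
    define c1 where "c1 = c / (2 * (\<bar>w y\<bar> + 1))"
    define c2 where "c2 = c / (2 * (\<bar>\<gamma>1\<bar> + 1))"
    have c12: "c1 > 0" "c2 > 0" using \<open>c > 0\<close> by (auto simp: c1_def c2_def add_nonneg_pos)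
    have "\<forall>\<^sub>F x in nhds y. \<bar>P x\<bar> < c2"
      using tendstoD[OF P0 c12(2)] by (simp add: dist_real_def)
    from eventually_compose_filterlim[OF taylor[OF c12(1)] limt]
      eventually_compose_filterlim[OF taylor[OF zero_less_one] limt]
      eventually_compose_filterlim[OF this limx]
    show "\<forall>\<^sub>F z in at (t0, y). norm (r z) \<le> c * norm (case z of (t, x) \<Rightarrow> \<bar>t - t0\<bar> + (norm (x - y))\<^sup>2)"
    proof eventually_elim
      case (elim z)
      obtain t x where z: "z = (t, x)" by fastforce
      have "\<bar>\<gamma> t - \<gamma> t0\<bar> \<le> \<bar>\<gamma>1 * (t - t0)\<bar> + \<bar>t - t0\<bar>" using elim(2) by (simp add: z)
      also have "\<dots> = (\<bar>\<gamma>1\<bar> + 1) * \<bar>t - t0\<bar>" by (simp add: abs_mult distrib_right)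
      finally have "\<bar>P x * (\<gamma> t - \<gamma> t0)\<bar> \<le> c2 * ((\<bar>\<gamma>1\<bar> + 1) * \<bar>t - t0\<bar>)"
        unfolding abs_mult using elim(3) c12 by (intro mult_mono) (auto simp: z)
      also have "\<dots> = c / 2 * \<bar>t - t0\<bar>" by (simp add: c2_def field_simps add_nonneg_eq_0_iff)
      finally have r2: "\<bar>P x * (\<gamma> t - \<gamma> t0)\<bar> \<le> c / 2 * \<bar>t - t0\<bar>" .
      have "\<bar>w y * (\<gamma> t - \<gamma> t0 - \<gamma>1 * (t - t0))\<bar> \<le> (\<bar>w y\<bar> + 1) * (c1 * \<bar>t - t0\<bar>)"
        unfolding abs_mult using elim(1) c12 by (intro mult_mono) (auto simp: z)
      also have "\<dots> = c / 2 * \<bar>t - t0\<bar>" by (simp add: c1_def field_simps add_nonneg_eq_0_iff)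
      finally have "\<bar>r z\<bar> \<le> c * \<bar>t - t0\<bar>" using r2 unfolding z r_def by simp
      also have "\<dots> \<le> c * (\<bar>t - t0\<bar> + (norm (x - y))\<^sup>2)" using \<open>c > 0\<close> by simp
      finally show ?case by (simp add: z)
    qed
  qed
  moreover have "\<forall>\<^sub>F (t, x) in at (t0, y).
          u (t, x) \<le> u (t0, y) + (\<gamma>1 * w y) * (t - t0) + (\<gamma> t0 *\<^sub>R p) \<bullet> (x - y)
                      + (1/2) * (((\<gamma> t0 *\<^sub>R X) *v (x - y)) \<bullet> (x - y)) + r (t, x)"
  proof -
    have "\<forall>\<^sub>F t in nhds t0. 0 < t \<and> t < T"
      using t0 by (intro eventually_nhds_in_open[of "{0<..<T}", simplified]) auto
    from eventually_compose_filterlim[OF this limt]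
      eventually_compose_filterlim[OF \<open>\<forall>\<^sub>F x in nhds y. w x \<le> w y + P x\<close> limx]
      le[unfolded eventually_nhds_conv_at, THEN conjunct1]
    show ?thesis
    proof eventually_elim
      case (elim z)
      obtain t x where z: "z = (t, x)" by fastforce
      have "g T t > 0" using pos[of t] elim(1) by (simp add: g_def z)
      have "g T t * (u (t, x) - e) \<le> w y + P x" using elim(2,3) by (simp add: z)
      then have "u (t, x) - e \<le> \<gamma> t * (w y + P x)"
        using \<open>g T t > 0\<close> by (simp add: \<gamma>_def field_simps)
      moreover have "u (t0, y) = e + \<gamma> t0 * w y"
        using \<gamma>0 unfolding eq by (simp add: \<gamma>_def)
      moreover have "(\<gamma> t0 *\<^sub>R p) \<bullet> (x - y) + (1/2) * (((\<gamma> t0 *\<^sub>R X) *v (x - y)) \<bullet> (x - y)) = \<gamma> t0 * P x"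
        by (simp add: P_def scaleR_matrix_vector_assoc[symmetric] distrib_left)
      ultimately show ?case
        by (simp add: z r_def algebra_simps)
    qed
  qed
  moreover have "transpose (\<gamma> t0 *\<^sub>R X) = \<gamma> t0 *\<^sub>R X"
    using X by (simp add: transpose_def vec_eq_iff)
  ultimately have "(\<gamma>1 * w y, \<gamma> t0 *\<^sub>R p, \<gamma> t0 *\<^sub>R X) \<in> par_superjet u (t0, y)"
    unfolding par_superjet_def by auto
  from sub[OF this] have "\<gamma>1 * w y - \<gamma> t0 ^ 3 * ((X *v p) \<bullet> p) \<le> 0"
    by (simp add: scaleR_matrix_vector_assoc[symmetric] matrix_vector_mult_scaleR power3_eq_cube)
  then have "\<gamma> t0 ^ 3 * (- (h' * w y / 2)) \<le> \<gamma> t0 ^ 3 * ((X *v p) \<bullet> p)"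
    by (simp add: \<gamma>1_def mult_ac)
  then have "- (h' * w y / 2) \<le> (X *v p) \<bullet> p"
    by (rule mult_left_le_imp_le) (use \<gamma>0 in simp)
  \<comment> \<open>The sign of \<open>w y\<close> and \<open>h' \<le> 1\<close> remove the
    time-dependent factor.\<close>
  moreover have "h' * w y \<le> 1 * w y"
    using t0 \<open>w y \<ge> 0\<close> by (intro mult_right_mono) (auto simp: h'_def)
  ultimately show "- (w y / 2) \<le> (X *v p) \<bullet> p" by simp
qed

text \<open>A polynomial above \<open>- f\<close> is the negative of one below \<open>f\<close>, and
  the cubic form changes sign with it; zero serves as the remainder of the jet.\<close>

lemma touch_bound_supersolution:
  fixes f :: "real^'n \<Rightarrow> real"
  assumes "ell_viscosity_supersolution \<Omega> f" "y \<in> \<Omega>"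
  shows "touch_bound (\<lambda>x. - f x) y (f y / 2)"
  unfolding touch_bound_def
proof (intro allI impI)
  fix p :: "real^'n" and X :: "real^'n^'n"
  assume X: "transpose X = X"
    and ev: "\<forall>\<^sub>F x in at y. - f x \<le> - f y + p \<bullet> (x - y) + (1/2) * ((X *v (x - y)) \<bullet> (x - y))"
  have "(p, X) \<in> ell_superjet (\<lambda>x. - f x) y"
    unfolding ell_superjet_def using X ev by (auto intro!: bexI[of _ "\<lambda>_. 0"])
  then have "(- p, - X) \<in> ell_subjet f y"
    unfolding ell_subjet_def by (metis imageI uminus_Pair)
  then have "0 \<le> - ((- X *v - p) \<bullet> - p) - f y / 2"
    using assms unfolding ell_viscosity_supersolution_def by fastforce
  moreover have "- X *v - p = X *v p"
    by (simp add: matrix_vector_mult_def vec_eq_iff)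
  ultimately show "f y / 2 \<le> (X *v p) \<bullet> p" by simp
qed

section \<open>Reduction of the decay estimate to the elliptic comparison\<close>

theorem corollary1p3:
  fixes \<Omega> :: "(real^'n) set"
    and u0 f :: "real^'n \<Rightarrow> real"
    and u :: "real \<times> (real^'n) \<Rightarrow> real"
  assumes "open \<Omega>" and "connected \<Omega>" and "\<Omega> \<noteq> {}" and "bounded \<Omega>"
    and "uniform_exterior_sphere \<Omega>"
    and "u0 \<in> C0_closure \<Omega>"
    and "\<forall>x\<in>closure \<Omega>. u0 x \<ge> 0"
    and "\<exists>x\<in>closure \<Omega>. u0 x \<noteq> 0"
    and "par_viscosity_solution \<Omega> u0 u"
    and "\<forall>z\<in>closure ({0<..} \<times> \<Omega>). u z \<ge> 0"
    and "f \<in> C0_closure \<Omega>"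
    and "ell_viscosity_solution \<Omega> f"
    and "\<forall>x\<in>\<Omega>. f x > 0"
  shows "\<forall>t>0. \<forall>x\<in>closure \<Omega>. u (t, x) \<le> t powr (-1/2) * f x"
proof (intro allI impI ballI)
  fix t1 :: real and x assume "t1 > 0" "x \<in> closure \<Omega>"
  have frontier: "frontier \<Omega> = closure \<Omega> - \<Omega>"
    using \<open>open \<Omega>\<close> by (simp add: frontier_def interior_open)
  have u_bdry: "u (t, y) \<le> 0" if "t \<ge> 0" "y \<in> frontier \<Omega>" for t y
  proof (cases "t = 0")
    case True
    have "u (0, y) \<le> u0 y" "u0 y = 0"
      using assms(6,9) that unfolding par_viscosity_solution_def par_viscosity_subsolution_def C0_closure_def
      by (auto simp: frontier)
    then show ?thesis using True by simp
  next
    case False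
    then show ?thesis
      using assms(9) that unfolding par_viscosity_solution_def par_viscosity_subsolution_def by simp
  qed
  show "u (t1, x) \<le> t1 powr (-1/2) * f x"
  proof (cases "x \<in> \<Omega>")
    case False
    then have "x \<in> frontier \<Omega>" using \<open>x \<in> closure \<Omega>\<close> by (simp add: frontier)
    moreover have "f x = 0" using assms(11) calculation by (simp add: C0_closure_def)
    ultimately show ?thesis using u_bdry[of t1 x] \<open>t1 > 0\<close> by simp
  next
    case True
    show ?thesis
    proof (rule ccontr)
      assume "\<not> ?thesis"
      moreover have "t1 powr (-1/2) = 1 / sqrt t1"
        using \<open>t1 > 0\<close> by (simp add: powr_minus_divide powr_half_sqrt)
      ultimately have gt: "f x / sqrt t1 < u (t1, x)" by simp
      \<comment> \<open>The strict inequality leaves room for lowering \<open>u\<close> by some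
        \<open>e > 0\<close> and then for replacing the square root of \<open>t1\<close> by
        \<open>g T t1\<close> with \<open>T\<close> large.\<close>
      then obtain c where c: "f x / sqrt t1 < c" "c < u (t1, x)" using dense by blast
      define e where "e = u (t1, x) - c"
      have "e > 0" "f x / sqrt t1 < u (t1, x) - e" using c by (simp_all add: e_def)
      then have gt': "f x < sqrt t1 * (u (t1, x) - e)" using \<open>t1 > 0\<close> by (simp add: field_simps)
      define g where "g T t = sqrt (t - t\<^sup>2 / T)" for T t :: real
      have "((\<lambda>T. g T t1 * (u (t1, x) - e)) \<longlongrightarrow> sqrt (t1 - 0) * (u (t1, x) - e)) at_top"
        unfolding g_def by (intro tendsto_intros tendsto_divide_0[OF tendsto_const] filterlim_at_top_imp_at_infinity filterlim_ident)
      then have "\<forall>\<^sub>F T in at_top. f x < g T t1 * (u (t1, x) - e)"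
        using gt' by (intro order_tendstoD(1)) simp_all
      then have "\<forall>\<^sub>F T in at_top. t1 < T \<and> f x < g T t1 * (u (t1, x) - e)"
        using eventually_gt_at_top by eventually_elim simp
      then obtain T where "t1 < T" and fx: "f x < g T t1 * (u (t1, x) - e)"
        using eventually_happens'[OF trivial_limit_at_top_linorder] by blast
      define I where "I = {0..T}"
      have I: "compact I" "I \<noteq> {}" "t1 \<in> I" using \<open>t1 < T\<close> \<open>t1 > 0\<close> by (auto simp: I_def)
      have "compact (closure \<Omega>)" using \<open>bounded \<Omega>\<close> by simp
      have "I \<times> closure \<Omega> \<subseteq> closure ({0<..} \<times> \<Omega>)"
        unfolding closure_Times by (auto simp: I_def)
      then have contu: "continuous_on (I \<times> closure \<Omega>) u"
        using assms(9) unfolding par_viscosity_solution_def by (blast intro: continuous_on_subset)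
      define F where "F t y = g T t * (u (t, y) - e)" for t y
      have contF: "continuous_on (I \<times> closure \<Omega>) (\<lambda>z. F (fst z) (snd z))"
        unfolding F_def g_def using \<open>t1 < T\<close> \<open>t1 > 0\<close> by (auto intro!: continuous_intros contu)
      define w where "w y = (SUP t\<in>I. F t y)" for y
      have w_attained: "\<exists>t\<in>I. w y = F t y \<and> (\<forall>s\<in>I. F s y \<le> w y)" if "y \<in> closure \<Omega>" for y
        using SUP_compact_attained[OF I(1,2) contF that] unfolding w_def by metis
      have contw: "continuous_on \<Omega> w"
        unfolding w_def
        by (rule continuous_on_subset[OF continuous_on_SUP_compact[OF I(1,2) \<open>compact (closure \<Omega>)\<close> contF] closure_subset])
      \<comment> \<open>For times in \<open>I\<close> and points closer than \<delta> to the
        frontier, \<open>u\<close> stays below \<open>e\<close>, which yields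
        \<open>w \<le> 0\<close> outside \<open>K\<close>.\<close>
      obtain \<delta> where "\<delta> > 0" and \<delta>: "\<forall>z\<in>I \<times> closure \<Omega>. \<forall>z'\<in>I \<times> closure \<Omega>. dist z' z < \<delta> \<longrightarrow> dist (u z') (u z) < e"
        using compact_uniformly_continuous[OF contu compact_Times[OF I(1) \<open>compact (closure \<Omega>)\<close>]] \<open>e > 0\<close>
        unfolding uniformly_continuous_on_def by blast
      define K where "K = closure \<Omega> \<inter> {y. \<delta> \<le> infdist y (frontier \<Omega>)}"
      have "frontier \<Omega> \<noteq> {}"
        using \<open>bounded \<Omega>\<close> \<open>\<Omega> \<noteq> {}\<close> not_bounded_UNIV by (auto simp: frontier_eq_empty)
      have "w x \<le> f x"
      proof (rule elliptic_comparison[OF \<open>open \<Omega>\<close> _ _ contw])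
        show "compact K"
          unfolding K_def using \<open>compact (closure \<Omega>)\<close>
          by (intro compact_Int_closed closed_Collect_le continuous_intros)
        show "K \<subseteq> \<Omega>"
        proof
          fix y assume y: "y \<in> K"
          then have "infdist y (frontier \<Omega>) \<noteq> 0" using \<open>\<delta> > 0\<close> by (auto simp: K_def)
          then have "y \<notin> frontier \<Omega>" using infdist_zero by metis
          then show "y \<in> \<Omega>" using y by (auto simp: K_def frontier)
        qed
        show "continuous_on \<Omega> f" using assms(12) by (simp add: ell_viscosity_solution_def)
        show "x \<in> \<Omega>" by fact
        show "0 < f y" if "y \<in> \<Omega>" for y using assms(13) that by blast
        show "touch_bound (\<lambda>x. - f x) y (f y / 2)" if "y \<in> \<Omega>" for y
          using assms(12) that by (auto simp: ell_viscosity_solution_def intro: touch_bound_supersolution)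
        show "w y \<le> 0" if "y \<in> \<Omega> - K" for y
        proof -
          have "y \<in> closure \<Omega>" using that closure_subset by blast
          then have "infdist y (frontier \<Omega>) < \<delta>" using that by (auto simp: K_def)
          moreover obtain y' where y': "y' \<in> frontier \<Omega>" "infdist y (frontier \<Omega>) = dist y y'"
            using infdist_attains_inf[OF frontier_closed \<open>frontier \<Omega> \<noteq> {}\<close>, of y] by blast
          ultimately have "dist y y' < \<delta>" by simp
          obtain t where t: "t \<in> I" "w y = F t y" using w_attained[OF \<open>y \<in> closure \<Omega>\<close>] by blast
          have "dist (u (t, y)) (u (t, y')) < e"
            using bspec[OF bspec[OF \<delta>, of "(t, y')"], of "(t, y)"] t(1) y'(1) \<open>y \<in> closure \<Omega>\<close> \<open>dist y y' < \<delta>\<close>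
            by (simp add: dist_Pair_Pair frontier)
          moreover have "u (t, y') \<le> 0" using u_bdry y'(1) t(1) by (simp add: I_def)
          ultimately have "u (t, y) - e \<le> 0" by (simp add: dist_real_def)
          moreover have "0 \<le> g T t"
          proof -
            have "t * t \<le> t * T" using t(1) by (intro mult_left_mono) (auto simp: I_def)
            then show ?thesis using \<open>t1 < T\<close> \<open>t1 > 0\<close> by (simp add: g_def power2_eq_square field_simps)
          qed
          ultimately show ?thesis unfolding t(2) F_def by (simp add: mult_nonneg_nonpos)
        qed
        show "touch_bound w y (- (w y / 2))" if y: "y \<in> \<Omega>" "0 < w y" for y
        proof -
          obtain t where t: "t \<in> I" "w y = F t y"
            using w_attained[OF subsetD[OF closure_subset y(1)]] by blast
          \<comment> \<open>\<open>g T\<close> vanishes at both ends of \<open>I\<close>, so a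
            positive maximum is attained at an interior time.\<close>
          have "g T t \<noteq> 0" using y(2) t(2) by (auto simp: F_def)
          then have tT: "0 < t" "t < T" using t(1) by (auto simp: g_def I_def power2_eq_square less_le)
          show ?thesis
          proof (rule touch_bound_time_max[OF tT])
            show "w y = sqrt (t - t\<^sup>2 / T) * (u (t, y) - e)" using t(2) by (simp add: F_def g_def)
            show "s - (X *v p) \<bullet> p \<le> 0" if "(s, p, X) \<in> par_superjet u (t, y)" for s p X
              using assms(9) that \<open>y \<in> \<Omega>\<close> tT(1)
              unfolding par_viscosity_solution_def par_viscosity_subsolution_def by fastforce
            have "\<forall>\<^sub>F z in nhds (t, y). z \<in> {0<..<T} \<times> \<Omega>"
              using tT \<open>y \<in> \<Omega>\<close> \<open>open \<Omega>\<close> by (intro eventually_nhds_in_open open_Times) auto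
            then show "\<forall>\<^sub>F z in nhds (t, y). sqrt (fst z - (fst z)\<^sup>2 / T) * (u z - e) \<le> w (snd z)"
            proof eventually_elim
              case (elim z)
              then have "fst z \<in> I" "snd z \<in> \<Omega>" by (auto simp: I_def)
              then have "F (fst z) (snd z) \<le> w (snd z)"
                using w_attained[OF subsetD[OF closure_subset]] by blast
              then show ?case by (simp add: F_def g_def)
            qed
          qed (use y in simp)
        qed
      qed
      moreover have "F t1 x \<le> w x" using w_attained[OF \<open>x \<in> closure \<Omega>\<close>] I(3) by blast
      ultimately show False using fx by (simp add: F_def)
    qed
  qed
qed

end
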